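(* Let $M^3$ be a three-dimensional Riemannian manifold and let $\gamma: I\to M^{3}$ be a regular curve with curvature $\kappa>0$, torsion $\tau$ and arc-length parameter $s$. Then $\gamma$ is a slant helix if, and only if, $$\frac{\mathrm{d}\sigma}{\mathrm{d}s}=0,\qquad \sigma=\frac{\kappa^2}{(\kappa^2+\tau^2)^{3/2}}\frac{\mathrm{d}}{\mathrm{d}s}\left(\frac{\tau}{\kappa}\right).$$ In addition, $\sigma=\cot(\theta)$ and the axis is $V=\cos(\theta)\,N+\sin(\theta)\,D$, where $\theta$ is a real constant with $\langle N,V\rangle=\cos\theta$ and $D=(\tau T+\kappa B)/\sqrt{\tau^2+\kappa^2}$.
   Context: $\nabla$ is the Levi-Civita connection of $M^3$. The (positively oriented orthonormal) Frenet frame $\{T,N,B\}$ satisfies $\nabla_TT=\kappa N$, $\nabla_TN=-\kappa T+\tau B$, $\nabla_TB=-\tau N$. The curve $\gamma$ is a (parallel) slant helix with axis $V$ if $V$ is a unit vector field along $\gamma$ with $\nabla_{\gamma'}V=0$ and the principal normal $N$ makes a constant angle with $V$; $\gamma$ is a slant helix if such an axis exists. *)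

theory Defs
  imports "HOL-Analysis.Analysis" "HOL-Library.Function_Algebras"
begin

section \<open>Smooth maps\<close>

text \<open>The derivative is taken within \<open>S\<close>, so that the notion applies both to open sets and to
  intervals with end points.  It is used only for sets on which the derivative within \<open>S\<close> is
  unique: open sets, and relatively open subsets of nondegenerate intervals.\<close>

fun Ck_on :: "nat \<Rightarrow> 'a::real_normed_vector set \<Rightarrow> ('a \<Rightarrow> 'b::real_normed_vector) \<Rightarrow> bool" where
  "Ck_on 0 S f \<longleftrightarrow> continuous_on S f"
| "Ck_on (Suc k) S f \<longleftrightarrow> f differentiable_on S \<and>
     (\<forall>v. Ck_on k S (\<lambda>x. frechet_derivative f (at x within S) v))"

definition smooth_on :: "'a::real_normed_vector set \<Rightarrow> ('a \<Rightarrow> 'b::real_normed_vector) \<Rightarrow> bool" where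
  "smooth_on S f \<longleftrightarrow> (\<forall>k. Ck_on k S f)"


section \<open>Riemannian 3-manifolds\<close>

type_synonym 'p chart = "'p set \<times> ('p \<Rightarrow> real^3)"

abbreviation chart_dom :: "'p chart \<Rightarrow> 'p set" where "chart_dom c \<equiv> fst c"
abbreviation chart_map :: "'p chart \<Rightarrow> 'p \<Rightarrow> real^3" where "chart_map c \<equiv> snd c"

text \<open>\<open>metric_tensor M c x\<close> is the matrix of components \<open>g\<^sub>i\<^sub>j\<close> of the metric in the chart \<open>c\<close>,
  at the point with coordinates \<open>x\<close>.\<close>

record 'p riemannian =
  manifold_top :: "'p topology"
  atlas :: "'p chart set"
  metric_tensor :: "'p chart \<Rightarrow> real^3 \<Rightarrow> real^3^3"

definition is_chart :: "'p topology \<Rightarrow> 'p chart \<Rightarrow> bool" where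
  "is_chart X c \<longleftrightarrow> openin X (chart_dom c) \<and> open (chart_map c ` chart_dom c) \<and>
     homeomorphic_map (subtopology X (chart_dom c))
       (top_of_set (chart_map c ` chart_dom c)) (chart_map c)"

definition transition :: "'p chart \<Rightarrow> 'p chart \<Rightarrow> real^3 \<Rightarrow> real^3" where
  "transition c d = chart_map d \<circ> inv_into (chart_dom c) (chart_map c)"

definition smooth_atlas :: "'p topology \<Rightarrow> 'p chart set \<Rightarrow> bool" where
  "smooth_atlas X A \<longleftrightarrow> (\<forall>c\<in>A. is_chart X c) \<and> (\<Union>c\<in>A. chart_dom c) = topspace X \<and>
     (\<forall>c\<in>A. \<forall>d\<in>A. smooth_on (chart_map c ` (chart_dom c \<inter> chart_dom d)) (transition c d))"

definition transition_matrix :: "'p chart \<Rightarrow> 'p chart \<Rightarrow> 'p \<Rightarrow> real^3^3" where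
  "transition_matrix c d p = jacobian (transition c d) (at (chart_map c p))"

definition charts_at :: "'p riemannian \<Rightarrow> 'p \<Rightarrow> 'p chart set" where
  "charts_at M p = {c \<in> atlas M. p \<in> chart_dom c}"

definition riemannian_3_manifold :: "'p riemannian \<Rightarrow> bool" where
  "riemannian_3_manifold M \<longleftrightarrow>
     Hausdorff_space (manifold_top M) \<and> second_countable (manifold_top M) \<and>
     smooth_atlas (manifold_top M) (atlas M) \<and>
     (\<forall>c\<in>atlas M. smooth_on (chart_map c ` chart_dom c) (metric_tensor M c) \<and>
        (\<forall>x \<in> chart_map c ` chart_dom c.
           transpose (metric_tensor M c x) = metric_tensor M c x \<and>
           (\<forall>v. v \<noteq> 0 \<longrightarrow> v \<bullet> (metric_tensor M c x *v v) > 0))) \<and>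
     (\<forall>p. \<forall>c\<in>charts_at M p. \<forall>d\<in>charts_at M p.
        metric_tensor M c (chart_map c p) =
          transpose (transition_matrix c d p) ** metric_tensor M d (chart_map d p)
            ** transition_matrix c d p)"


section \<open>Tangent vectors\<close>

text \<open>A tangent vector at \<open>p\<close> is given by its components in all charts around \<open>p\<close>, which are
  related by the contravariant transformation law.  The value \<open>0\<close> at all other charts makes
  the representation unique, so that equality of tangent vectors is equality of functions.
  Sums and the zero vector are those of functions.\<close>

type_synonym 'p tangent = "'p chart \<Rightarrow> real^3"

definition tangent_space :: "'p riemannian \<Rightarrow> 'p \<Rightarrow> 'p tangent set" where
  "tangent_space M p = {v. (\<forall>c. c \<notin> charts_at M p \<longrightarrow> v c = 0) \<and>
     (\<forall>c\<in>charts_at M p. \<forall>d\<in>charts_at M p. v d = transition_matrix c d p *v v c)}"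

definition tscale :: "real \<Rightarrow> 'p tangent \<Rightarrow> 'p tangent" (infixr "*\<^sub>T" 75) where
  "a *\<^sub>T v = (\<lambda>c. a *\<^sub>R v c)"

text \<open>The choice of the chart is irrelevant by the transformation laws.\<close>

definition rinner :: "'p riemannian \<Rightarrow> 'p \<Rightarrow> 'p tangent \<Rightarrow> 'p tangent \<Rightarrow> real" where
  "rinner M p v w =
     (let c = (SOME c. c \<in> charts_at M p) in v c \<bullet> (metric_tensor M c (chart_map c p) *v w c))"

definition rnorm :: "'p riemannian \<Rightarrow> 'p \<Rightarrow> 'p tangent \<Rightarrow> real" where
  "rnorm M p v = sqrt (rinner M p v v)"

definition rangle :: "'p riemannian \<Rightarrow> 'p \<Rightarrow> 'p tangent \<Rightarrow> 'p tangent \<Rightarrow> real" where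
  "rangle M p v w = arccos (rinner M p v w / (rnorm M p v * rnorm M p w))"


section \<open>The Levi-Civita connection in coordinates\<close>

definition metric_deriv :: "'p riemannian \<Rightarrow> 'p chart \<Rightarrow> real^3 \<Rightarrow> 3 \<Rightarrow> 3 \<Rightarrow> 3 \<Rightarrow> real" where
  "metric_deriv M c x k i j = frechet_derivative (metric_tensor M c) (at x) (axis k 1) $ i $ j"

text \<open>\<open>christoffel M c x k i j\<close> is \<open>\<Gamma>\<^sup>k\<^sub>i\<^sub>j\<close>.\<close>

definition christoffel :: "'p riemannian \<Rightarrow> 'p chart \<Rightarrow> real^3 \<Rightarrow> 3 \<Rightarrow> 3 \<Rightarrow> 3 \<Rightarrow> real" where
  "christoffel M c x k i j = (1/2) * (\<Sum>l\<in>UNIV. matrix_inv (metric_tensor M c x) $ k $ l *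
     (metric_deriv M c x i j l + metric_deriv M c x j i l - metric_deriv M c x l i j))"

text \<open>These are the coefficients of the unique connection that is torsion-free and compatible
  with the metric.\<close>

definition levi_civita_at ::
  "'p riemannian \<Rightarrow> 'p chart \<Rightarrow> real^3 \<Rightarrow> (3 \<Rightarrow> 3 \<Rightarrow> 3 \<Rightarrow> real) \<Rightarrow> bool" where
  "levi_civita_at M c x \<Gamma> \<longleftrightarrow> (\<forall>k i j. \<Gamma> k i j = \<Gamma> k j i) \<and>
     (\<forall>k i j. metric_deriv M c x k i j =
        (\<Sum>l\<in>UNIV. \<Gamma> l k i * metric_tensor M c x $ l $ j) + (\<Sum>l\<in>UNIV. \<Gamma> l k j * metric_tensor M c x $ i $ l))"

lemma levi_civita_at_iff:
  assumes M: "riemannian_3_manifold M" and c: "c \<in> atlas M"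
    and x: "x \<in> chart_map c ` chart_dom c"
  shows "levi_civita_at M c x \<Gamma> \<longleftrightarrow> \<Gamma> = christoffel M c x"
proof -
  let ?g = "metric_tensor M c x"
  let ?h = "matrix_inv ?g"
  let ?d = "metric_deriv M c x"
  let ?U = "chart_map c ` chart_dom c"
  have ch: "is_chart (manifold_top M) c" and sm: "smooth_on ?U (metric_tensor M c)"
    and sym: "\<And>y. y \<in> ?U \<Longrightarrow> transpose (metric_tensor M c y) = metric_tensor M c y"
    and pos: "\<And>v. v \<noteq> 0 \<Longrightarrow> v \<bullet> (?g *v v) > 0"
    using M c x unfolding riemannian_3_manifold_def smooth_atlas_def by blast+
  have op: "open ?U" using ch by (simp add: is_chart_def)
  have gs: "metric_tensor M c y $ i $ j = metric_tensor M c y $ j $ i" if "y \<in> ?U" for y i j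
    using arg_cong[OF sym[OF that], of "\<lambda>A. A $ j $ i"] by (simp add: transpose_def)
  have delta: "(\<Sum>l\<in>UNIV. (if a = l then 1 else 0) * f l) = f a" for a :: 3 and f :: "3 \<Rightarrow> real"
  proof -
    have "(\<Sum>l\<in>UNIV. (if a = l then 1 else 0) * f l) = (\<Sum>l\<in>UNIV. if a = l then f l else 0)"
      by (rule sum.cong) auto
    then show ?thesis by simp
  qed
  have "inj ((*v) ?g)"
  proof (rule injI)
    fix v w assume "?g *v v = ?g *v w"
    then have "?g *v (v - w) = 0" by (simp add: matrix_vector_mult_diff_distrib)
    then have "v - w = 0" using pos[of "v - w"] by force
    then show "v = w" by simp
  qed
  then have inv: "invertible ?g" by (simp add: invertible_left_inverse matrix_left_invertible_injective)
  have gh: "?g ** ?h = mat 1" and hg: "?h ** ?g = mat 1"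
    using someI_ex[OF inv[unfolded invertible_def]] unfolding matrix_inv_def by auto
  have GH: "(\<Sum>l\<in>UNIV. ?g $ i $ l * ?h $ l $ j) = (if i = j then 1 else 0)" for i j
    using arg_cong[OF gh, of "\<lambda>A. A $ i $ j"] by (simp add: matrix_matrix_mult_def mat_def)
  have HG: "(\<Sum>l\<in>UNIV. ?h $ i $ l * ?g $ l $ j) = (if i = j then 1 else 0)" for i j
    using arg_cong[OF hg, of "\<lambda>A. A $ i $ j"] by (simp add: matrix_matrix_mult_def mat_def)
  have "Ck_on (Suc 0) ?U (metric_tensor M c)" using sm unfolding smooth_on_def by blast
  then have "metric_tensor M c differentiable (at x within ?U)"
    using x unfolding Ck_on.simps differentiable_on_def by blast
  then have "metric_tensor M c differentiable (at x)" using at_within_open[OF x op] by simp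
  then have D: "(metric_tensor M c has_derivative frechet_derivative (metric_tensor M c) (at x)) (at x)"
    by (simp add: frechet_derivative_works)
  have comp: "((\<lambda>y. metric_tensor M c y $ i $ j) has_derivative
      (\<lambda>v. frechet_derivative (metric_tensor M c) (at x) v $ i $ j)) (at x)" for i j
    by (intro bounded_linear.has_derivative[OF bounded_linear_vec_nth] D)
  have ds: "?d k i j = ?d k j i" for k i j
  proof -
    have "((\<lambda>y. metric_tensor M c y $ i $ j) has_derivative
      (\<lambda>v. frechet_derivative (metric_tensor M c) (at x) v $ j $ i)) (at x)"
      by (rule has_derivative_transform_within_open[OF comp[of j i] op x]) (simp add: gs)
    from has_derivative_unique[OF this comp[of i j]] show ?thesis
      unfolding metric_deriv_def by metis
  qed
  have low: "(\<Sum>k\<in>UNIV. ?g $ m $ k * christoffel M c x k i j)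
      = (1/2) * (?d i j m + ?d j i m - ?d m i j)" for m i j
  proof -
    let ?e = "\<lambda>l. ?d i j l + ?d j i l - ?d l i j"
    have "(\<Sum>k\<in>UNIV. ?g $ m $ k * christoffel M c x k i j)
        = (\<Sum>k\<in>UNIV. \<Sum>l\<in>UNIV. (1/2) * (?g $ m $ k * ?h $ k $ l * ?e l))"
      unfolding christoffel_def sum_distrib_left by (intro sum.cong refl) (simp only: mult_ac)
    also have "\<dots> = (\<Sum>l\<in>UNIV. \<Sum>k\<in>UNIV. (1/2) * (?g $ m $ k * ?h $ k $ l * ?e l))"
      by (rule sum.swap)
    also have "\<dots> = (\<Sum>l\<in>UNIV. (1/2) * ((\<Sum>k\<in>UNIV. ?g $ m $ k * ?h $ k $ l) * ?e l))"
      by (simp only: sum_distrib_left sum_distrib_right)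
    also have "\<dots> = (1/2) * ?e m"
      unfolding GH sum_distrib_left[symmetric] delta ..
    finally show ?thesis .
  qed
  show ?thesis
  proof
    assume L: "levi_civita_at M c x \<Gamma>"
    define G where "G m i j = (\<Sum>k\<in>UNIV. ?g $ m $ k * \<Gamma> k i j)" for m i j
    have Gs: "G m i j = G m j i" for m i j
      using L unfolding G_def levi_civita_at_def by metis
    have dG: "?d k i j = G j k i + G i k j" for k i j
    proof -
      have "?d k i j = (\<Sum>l\<in>UNIV. \<Gamma> l k i * ?g $ l $ j) + (\<Sum>l\<in>UNIV. \<Gamma> l k j * ?g $ i $ l)"
        using L unfolding levi_civita_at_def by blast
      also have "\<dots> = G j k i + G i k j" unfolding G_def
        by (intro arg_cong2[where f = plus] sum.cong refl) (metis gs[OF x] mult.commute)+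
      finally show ?thesis .
    qed
    have G: "G m i j = (1/2) * (?d i j m + ?d j i m - ?d m i j)" for m i j
      unfolding dG Gs[of m j i] Gs[of j m i] Gs[of i m j] by (simp add: field_simps)
    have "\<Gamma> n i j = christoffel M c x n i j" for n i j
    proof -
      have "christoffel M c x n i j = (\<Sum>l\<in>UNIV. ?h $ n $ l * G l i j)"
        unfolding christoffel_def G sum_distrib_left by (intro sum.cong refl) (simp only: mult_ac)
      also have "\<dots> = (\<Sum>l\<in>UNIV. \<Sum>k\<in>UNIV. ?h $ n $ l * ?g $ l $ k * \<Gamma> k i j)"
        unfolding G_def sum_distrib_left by (intro sum.cong refl) (simp only: mult_ac)
      also have "\<dots> = (\<Sum>k\<in>UNIV. \<Sum>l\<in>UNIV. ?h $ n $ l * ?g $ l $ k * \<Gamma> k i j)"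
        by (rule sum.swap)
      also have "\<dots> = (\<Sum>k\<in>UNIV. (\<Sum>l\<in>UNIV. ?h $ n $ l * ?g $ l $ k) * \<Gamma> k i j)"
        by (simp only: sum_distrib_right)
      also have "\<dots> = \<Gamma> n i j"
        unfolding HG delta ..
      finally show ?thesis by simp
    qed
    then show "\<Gamma> = christoffel M c x" by blast
  next
    assume E: "\<Gamma> = christoffel M c x"
    have "christoffel M c x k i j = christoffel M c x k j i" for k i j
      unfolding christoffel_def using ds[of _ i j] by (intro arg_cong2[where f = times] sum.cong refl) simp
    moreover have "?d k i j = (\<Sum>l\<in>UNIV. christoffel M c x l k i * ?g $ l $ j)
        + (\<Sum>l\<in>UNIV. christoffel M c x l k j * ?g $ i $ l)" for k i j
    proof -
      have "(\<Sum>l\<in>UNIV. christoffel M c x l k i * ?g $ l $ j)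
        = (1/2) * (?d k i j + ?d i k j - ?d j k i)"
        unfolding low[symmetric] by (intro sum.cong refl) (metis gs[OF x] mult.commute)
      moreover have "(\<Sum>l\<in>UNIV. christoffel M c x l k j * ?g $ i $ l)
        = (1/2) * (?d k j i + ?d j k i - ?d i k j)"
        unfolding low[symmetric] by (intro sum.cong refl) (rule mult.commute)
      ultimately show ?thesis using ds[of k i j] by simp
    qed
    ultimately show "levi_civita_at M c x \<Gamma>" unfolding levi_civita_at_def E by blast
  qed
qed

section \<open>Curves and vector fields along curves\<close>

definition smooth_curve :: "'p riemannian \<Rightarrow> real set \<Rightarrow> (real \<Rightarrow> 'p) \<Rightarrow> bool" where
  "smooth_curve M I \<gamma> \<longleftrightarrow> continuous_map (top_of_set I) (manifold_top M) \<gamma> \<and>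
     (\<forall>c\<in>atlas M. smooth_on {t\<in>I. \<gamma> t \<in> chart_dom c} (chart_map c \<circ> \<gamma>))"

definition velocity :: "'p riemannian \<Rightarrow> real set \<Rightarrow> (real \<Rightarrow> 'p) \<Rightarrow> real \<Rightarrow> 'p tangent" where
  "velocity M I \<gamma> t = (\<lambda>c. if c \<in> charts_at M (\<gamma> t)
     then vector_derivative (chart_map c \<circ> \<gamma>) (at t within I) else 0)"

definition unit_speed :: "'p riemannian \<Rightarrow> real set \<Rightarrow> (real \<Rightarrow> 'p) \<Rightarrow> bool" where
  "unit_speed M I \<gamma> \<longleftrightarrow> (\<forall>t\<in>I. rnorm M (\<gamma> t) (velocity M I \<gamma> t) = 1)"

definition vector_field_along ::
  "'p riemannian \<Rightarrow> real set \<Rightarrow> (real \<Rightarrow> 'p) \<Rightarrow> (real \<Rightarrow> 'p tangent) \<Rightarrow> bool" where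
  "vector_field_along M I \<gamma> V \<longleftrightarrow> (\<forall>t\<in>I. V t \<in> tangent_space M (\<gamma> t) \<and>
     (\<forall>c\<in>charts_at M (\<gamma> t). (\<lambda>s. V s c) differentiable (at t within I)))"

text \<open>The covariant derivative of \<open>V\<close> along \<open>\<gamma>\<close>, with components
  \<open>dV\<^sup>k/dt + \<Sum>\<^sub>i\<^sub>j \<Gamma>\<^sup>k\<^sub>i\<^sub>j (\<gamma>')\<^sup>i V\<^sup>j\<close>.\<close>

definition cov_deriv ::
  "'p riemannian \<Rightarrow> real set \<Rightarrow> (real \<Rightarrow> 'p) \<Rightarrow> (real \<Rightarrow> 'p tangent) \<Rightarrow> real \<Rightarrow> 'p tangent" where
  "cov_deriv M I \<gamma> V t = (\<lambda>c. if c \<in> charts_at M (\<gamma> t)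
     then vector_derivative (\<lambda>s. V s c) (at t within I) +
       (\<chi> k. \<Sum>i\<in>UNIV. \<Sum>j\<in>UNIV. christoffel M c (chart_map c (\<gamma> t)) k i j *
          velocity M I \<gamma> t c $ i * V t c $ j)
     else 0)"

text \<open>An orientation of the tangent spaces along \<open>\<gamma>\<close>: \<open>\<omega> t c\<close> is the sign of the coordinate frame
  of the chart \<open>c\<close> at \<open>\<gamma> t\<close>.  An orientation of the manifold restricts to such an orientation, but
  the manifold need not be orientable for it to exist.\<close>

definition orientation_along ::
  "'p riemannian \<Rightarrow> real set \<Rightarrow> (real \<Rightarrow> 'p) \<Rightarrow> (real \<Rightarrow> 'p chart \<Rightarrow> real) \<Rightarrow> bool" where
  "orientation_along M I \<gamma> \<omega> \<longleftrightarrow>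
     (\<forall>t\<in>I. \<forall>c\<in>charts_at M (\<gamma> t). \<omega> t c \<in> {-1, 1} \<and>
        (\<forall>d\<in>charts_at M (\<gamma> t). \<omega> t d = sgn (det (transition_matrix c d (\<gamma> t))) * \<omega> t c)) \<and>
     (\<forall>c\<in>atlas M. continuous_on {t\<in>I. \<gamma> t \<in> chart_dom c} (\<lambda>t. \<omega> t c))"

definition frenet_frame ::
  "'p riemannian \<Rightarrow> real set \<Rightarrow> (real \<Rightarrow> 'p) \<Rightarrow> (real \<Rightarrow> 'p chart \<Rightarrow> real) \<Rightarrow>
   (real \<Rightarrow> real) \<Rightarrow> (real \<Rightarrow> real) \<Rightarrow>
   (real \<Rightarrow> 'p tangent) \<Rightarrow> (real \<Rightarrow> 'p tangent) \<Rightarrow> (real \<Rightarrow> 'p tangent) \<Rightarrow> bool" where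
  "frenet_frame M I \<gamma> \<omega> \<kappa> \<tau> T N B \<longleftrightarrow>
     (\<forall>t\<in>I. T t = velocity M I \<gamma> t) \<and>
     vector_field_along M I \<gamma> T \<and> vector_field_along M I \<gamma> N \<and> vector_field_along M I \<gamma> B \<and>
     (\<forall>t\<in>I. rnorm M (\<gamma> t) (T t) = 1 \<and> rnorm M (\<gamma> t) (N t) = 1 \<and> rnorm M (\<gamma> t) (B t) = 1 \<and>
        rinner M (\<gamma> t) (T t) (N t) = 0 \<and> rinner M (\<gamma> t) (T t) (B t) = 0 \<and>
        rinner M (\<gamma> t) (N t) (B t) = 0 \<and>
        (\<forall>c\<in>charts_at M (\<gamma> t). \<omega> t c * det (vector [T t c, N t c, B t c] :: real^3^3) > 0)) \<and>
     (\<forall>t\<in>I. cov_deriv M I \<gamma> T t = \<kappa> t *\<^sub>T N t \<and>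
        cov_deriv M I \<gamma> N t = (- \<kappa> t) *\<^sub>T T t + \<tau> t *\<^sub>T B t \<and>
        cov_deriv M I \<gamma> B t = (- \<tau> t) *\<^sub>T N t)"


section \<open>Slant helices\<close>

definition slant_axis ::
  "'p riemannian \<Rightarrow> real set \<Rightarrow> (real \<Rightarrow> 'p) \<Rightarrow> (real \<Rightarrow> 'p tangent) \<Rightarrow> (real \<Rightarrow> 'p tangent) \<Rightarrow> bool" where
  "slant_axis M I \<gamma> N V \<longleftrightarrow> vector_field_along M I \<gamma> V \<and>
     (\<forall>t\<in>I. rnorm M (\<gamma> t) (V t) = 1) \<and>
     (\<forall>t\<in>I. cov_deriv M I \<gamma> V t = 0) \<and>
     (\<exists>\<alpha>. \<forall>t\<in>I. rangle M (\<gamma> t) (N t) (V t) = \<alpha>)"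

definition slant_helix ::
  "'p riemannian \<Rightarrow> real set \<Rightarrow> (real \<Rightarrow> 'p) \<Rightarrow> (real \<Rightarrow> 'p tangent) \<Rightarrow> bool" where
  "slant_helix M I \<gamma> N \<longleftrightarrow> (\<exists>V. slant_axis M I \<gamma> N V)"

definition slant_sigma :: "real set \<Rightarrow> (real \<Rightarrow> real) \<Rightarrow> (real \<Rightarrow> real) \<Rightarrow> real \<Rightarrow> real" where
  "slant_sigma I \<kappa> \<tau> s = (\<kappa> s)\<^sup>2 / ((\<kappa> s)\<^sup>2 + (\<tau> s)\<^sup>2) powr (3/2) *
     vector_derivative (\<lambda>u. \<tau> u / \<kappa> u) (at s within I)"

definition slant_D ::
  "(real \<Rightarrow> real) \<Rightarrow> (real \<Rightarrow> real) \<Rightarrow> (real \<Rightarrow> 'p tangent) \<Rightarrow> (real \<Rightarrow> 'p tangent) \<Rightarrow> real \<Rightarrow> 'p tangent" where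
  "slant_D \<kappa> \<tau> T B s =
     (1 / sqrt ((\<tau> s)\<^sup>2 + (\<kappa> s)\<^sup>2)) *\<^sub>T (\<tau> s *\<^sub>T T s + \<kappa> s *\<^sub>T B s)"

end

theory Submission
  imports Defs
begin

text \<open>Write \<open>a, n, b\<close> for the components of a parallel unit field \<open>V\<close> in the Frenet frame, so that
  \<open>a' = \<kappa>n\<close>, \<open>n' = -\<kappa>a + \<tau>b\<close>, \<open>b' = -\<tau>n\<close>. If \<open>n\<close> is constant, then \<open>\<kappa>a = \<tau>b\<close>; hence \<open>(a, b)\<close> is a multiple
  \<open>\<lambda>(\<tau>, \<kappa>)/\<rho>\<close> with \<open>\<rho> = \<surd>(\<kappa>\<^sup>2 + \<tau>\<^sup>2)\<close> and \<open>\<lambda>\<^sup>2 = 1 - n\<^sup>2\<close> constant and nonzero, and differentiating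
  \<open>\<tau>/\<kappa> = a/b\<close> gives \<open>\<sigma> = n/\<lambda>\<close>. Conversely, if \<open>\<sigma> = cot \<theta>\<close> is constant, the components
  \<open>sin \<theta> \<tau>/\<rho>\<close>, \<open>cos \<theta>\<close>, \<open>sin \<theta> \<kappa>/\<rho>\<close> satisfy the three equations.

  The converse needs \<open>\<kappa>\<close> and \<open>\<tau>\<close> to be differentiable, although the frame is only assumed to be so once.
  In a chart with Gram matrix \<open>g\<close> and connection matrix \<open>C\<close>, the covector \<open>A = g \<nabla>\<^sub>TT = gx'' + gCx'\<close> is
  smooth, \<open>\<kappa> = N \<bullet> A\<close>, and \<open>g' = C\<^sup>Tg + gC\<close> yields \<open>\<tau> = (B \<bullet> A')/\<kappa> - N \<bullet> gCB\<close>.\<close>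

section \<open>Iterated differentiability in one variable\<close>

text \<open>Each derivative is given by a witness instead of \<open>frechet_derivative\<close>, and
  no continuity is asked at order 0. Hence the rules for sums and products hold on every set
  \<open>S\<close>, even where derivatives within \<open>S\<close> are not unique.\<close>

fun iter_differentiable_on :: "nat \<Rightarrow> real set \<Rightarrow> (real \<Rightarrow> 'a::real_normed_vector) \<Rightarrow> bool" where
  "iter_differentiable_on 0 S f \<longleftrightarrow> True"
| "iter_differentiable_on (Suc k) S f \<longleftrightarrow>
     (\<exists>f'. (\<forall>t\<in>S. (f has_vector_derivative f' t) (at t within S)) \<and> iter_differentiable_on k S f')"

lemma iter_differentiable_on_SucI:
  assumes "\<And>t. t \<in> S \<Longrightarrow> (f has_vector_derivative f' t) (at t within S)"
    and "iter_differentiable_on k S f'"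
  shows "iter_differentiable_on (Suc k) S f"
  using assms by auto

lemma iter_differentiable_on_mono:
  "iter_differentiable_on (Suc k) S f \<Longrightarrow> iter_differentiable_on k S f"
proof (induction k arbitrary: f)
  case (Suc k)
  then obtain f' where "\<forall>t\<in>S. (f has_vector_derivative f' t) (at t within S)"
    "iter_differentiable_on (Suc k) S f'"
    using Suc.prems unfolding iter_differentiable_on.simps(2)[of "Suc k"] by blast
  with Suc.IH show ?case by (intro iter_differentiable_on_SucI[of _ _ f']) auto
qed simp

lemma iter_differentiable_on_transform:
  assumes "iter_differentiable_on k S f" "\<And>t. t \<in> S \<Longrightarrow> f t = g t"
  shows "iter_differentiable_on k S g"
proof (cases k)
  case (Suc j)
  have "(g has_vector_derivative D) (at t within S)"
    if "t \<in> S" "(f has_vector_derivative D) (at t within S)" for t D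
    using that assms(2) by (metis has_vector_derivative_transform)
  then show ?thesis using assms(1) unfolding Suc by auto
qed simp

lemma iter_differentiable_on_zero: "iter_differentiable_on k S (\<lambda>_. 0)"
  by (induction k) (auto intro!: exI[of _ "\<lambda>_. 0"])

lemma iter_differentiable_on_const: "iter_differentiable_on k S (\<lambda>_. a)"
  by (cases k) (auto intro!: exI[of _ "\<lambda>_. 0"] iter_differentiable_on_zero)

lemma iter_differentiable_on_add:
  "iter_differentiable_on k S f \<Longrightarrow> iter_differentiable_on k S g \<Longrightarrow>
   iter_differentiable_on k S (\<lambda>t. f t + g t)"
proof (induction k arbitrary: f g)
  case (Suc k)
  then obtain f' g' where "\<forall>t\<in>S. (f has_vector_derivative f' t) (at t within S)"
    "\<forall>t\<in>S. (g has_vector_derivative g' t) (at t within S)"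
    "iter_differentiable_on k S f'" "iter_differentiable_on k S g'"
    by auto
  with Suc.IH show ?case
    by (auto intro!: exI[of _ "\<lambda>t. f' t + g' t"] has_vector_derivative_add)
qed simp

lemma iter_differentiable_on_sum:
  assumes "\<And>i. i \<in> A \<Longrightarrow> iter_differentiable_on k S (f i)"
  shows "iter_differentiable_on k S (\<lambda>t. \<Sum>i\<in>A. f i t)"
  using assms
  by (induction A rule: infinite_finite_induct)
    (auto intro: iter_differentiable_on_zero iter_differentiable_on_add)

lemma iter_differentiable_on_bounded_linear:
  assumes "bounded_linear h"
  shows "iter_differentiable_on k S f \<Longrightarrow> iter_differentiable_on k S (\<lambda>t. h (f t))"
proof (induction k arbitrary: f)
  case (Suc k)
  then obtain f' where "\<forall>t\<in>S. (f has_vector_derivative f' t) (at t within S)"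
    "iter_differentiable_on k S f'"
    by auto
  with Suc.IH show ?case
    by (auto intro!: exI[of _ "\<lambda>t. h (f' t)"] bounded_linear.has_vector_derivative[OF assms])
qed simp

lemma iter_differentiable_on_bounded_bilinear:
  assumes "bounded_bilinear h"
  shows "iter_differentiable_on k S f \<Longrightarrow> iter_differentiable_on k S g \<Longrightarrow>
    iter_differentiable_on k S (\<lambda>t. h (f t) (g t))"
proof (induction k arbitrary: f g)
  case (Suc k)
  then obtain f' g' where 1: "\<forall>t\<in>S. (f has_vector_derivative f' t) (at t within S)"
    "\<forall>t\<in>S. (g has_vector_derivative g' t) (at t within S)"
    "iter_differentiable_on k S f'" "iter_differentiable_on k S g'"
    by auto
  \<comment> \<open>Each summand of the product rule contains one factor undifferentiated, for which
    the induction hypothesis asks order \<open>k\<close>.\<close>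
  have 2: "iter_differentiable_on k S f" "iter_differentiable_on k S g"
    using Suc.prems iter_differentiable_on_mono by blast+
  show ?case
    using 1 2 Suc.IH
    by (auto intro!: exI[of _ "\<lambda>t. h (f t) (g' t) + h (f' t) (g t)"]
        bounded_bilinear.has_vector_derivative[OF assms] iter_differentiable_on_add)
qed simp

text \<open>A vector is the finite sum of its entries, each put in its place by a bounded linear
  map. The entries may lie in any normed space, so that two applications build a matrix.\<close>

lemma iter_differentiable_on_vec_lambda:
  fixes f :: "'n::finite \<Rightarrow> real \<Rightarrow> 'a::real_normed_vector"
  assumes "\<And>i. iter_differentiable_on k S (f i)"
  shows "iter_differentiable_on k S (\<lambda>t. \<chi> i. f i t)"
proof -
  have bl: "bounded_linear (\<lambda>x::'a. \<chi> j. if j = i then x else 0)" for i :: 'n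
  proof (rule bounded_linear_intro)
    fix x :: 'a
    have "norm (\<chi> j. if j = i then x else 0) \<le> (\<Sum>j\<in>UNIV. norm (if j = i then x else 0))"
      unfolding norm_vec_def by (rule order_trans[OF L2_set_le_sum]) auto
    also have "\<dots> = norm x" by (simp add: if_distrib cong: if_cong)
    finally show "norm (\<chi> j. if j = i then x else 0) \<le> norm x * 1" by simp
  qed (auto simp: vec_eq_iff)
  have "(\<chi> i. f i t) = (\<Sum>i\<in>UNIV. \<chi> j. if j = i then f i t else 0)" for t
    by (simp add: vec_eq_iff)
  then show ?thesis
    by (simp add: iter_differentiable_on_sum iter_differentiable_on_bounded_linear[OF bl] assms)
qed

section \<open>Composition of curves with maps of several variables\<close>

lemma has_vector_derivative_compose_within:
  assumes "(x has_vector_derivative x') (at t within S)" "(f has_derivative f') (at (x t))"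
  shows "((\<lambda>t. f (x t)) has_vector_derivative f' x') (at t within S)"
proof -
  have "(f \<circ> x has_derivative f' \<circ> (\<lambda>h. h *\<^sub>R x')) (at t within S)"
    using assms(1) unfolding has_vector_derivative_def
    by (rule diff_chain_within) (rule has_derivative_at_withinI[OF assms(2)])
  moreover have "f' \<circ> (\<lambda>h. h *\<^sub>R x') = (\<lambda>h. h *\<^sub>R f' x')"
    using has_derivative_linear[OF assms(2)] by (auto simp: linear_scale)
  ultimately show ?thesis by (simp add: has_vector_derivative_def o_def)
qed

lemma Ck_on_Suc_has_derivative:
  assumes "Ck_on (Suc k) U f" "open U" "y \<in> U"
  shows "(f has_derivative frechet_derivative f (at y)) (at y)"
  using assms at_within_open[OF assms(3,2)]
  unfolding Ck_on.simps differentiable_on_def frechet_derivative_works by metis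

lemma iter_differentiable_on_compose:
  fixes f :: "'a::euclidean_space \<Rightarrow> 'b::real_normed_vector"
  assumes U: "open U" "x ` S \<subseteq> U"
  shows "Ck_on k U f \<Longrightarrow> iter_differentiable_on k S x \<Longrightarrow> iter_differentiable_on k S (\<lambda>t. f (x t))"
proof (induction k arbitrary: f)
  case (Suc k)
  obtain x' where x': "\<And>t. t \<in> S \<Longrightarrow> (x has_vector_derivative x' t) (at t within S)"
    "iter_differentiable_on k S x'"
    using Suc.prems by auto
  \<comment> \<open>Derivatives within \<open>U\<close> are the ones in the recursion of
    \<open>Ck_on\<close>, so the induction hypothesis applies to each \<open>?D b\<close>; as
    \<open>U\<close> is open, \<open>E\<close> identifies them with unrestricted ones.\<close>
  let ?D = "\<lambda>b y. frechet_derivative f (at y within U) b"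
  have E: "?D v y = frechet_derivative f (at y) v" if "y \<in> U" for y v
    using at_within_open[OF that U(1)] by simp
  \<comment> \<open>Expanding \<open>x' t\<close> in the basis turns the chain rule into a finite
    sum of products, whose factors are \<open>k\<close> times differentiable.\<close>
  have "((\<lambda>t. f (x t)) has_vector_derivative (\<Sum>b\<in>Basis. (x' t \<bullet> b) *\<^sub>R ?D b (x t))) (at t within S)"
    if t: "t \<in> S" for t
  proof -
    have xt: "x t \<in> U" using t U by auto
    note D = Ck_on_Suc_has_derivative[OF Suc.prems(1) U(1) xt]
    have "frechet_derivative f (at (x t)) (\<Sum>b\<in>Basis. (x' t \<bullet> b) *\<^sub>R b)
        = (\<Sum>b\<in>Basis. (x' t \<bullet> b) *\<^sub>R ?D b (x t))"
      using has_derivative_linear[OF D] by (simp add: linear_sum linear_scale E[OF xt])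
    then show ?thesis
      using has_vector_derivative_compose_within[OF x'(1)[OF t] D]
      by (simp add: euclidean_representation)
  qed
  moreover have "iter_differentiable_on k S (\<lambda>t. \<Sum>b\<in>Basis. (x' t \<bullet> b) *\<^sub>R ?D b (x t))"
  proof (intro iter_differentiable_on_sum
      iter_differentiable_on_bounded_bilinear[OF bounded_bilinear_scaleR])
    fix b
    show "iter_differentiable_on k S (\<lambda>t. x' t \<bullet> b)"
      by (intro iter_differentiable_on_bounded_linear[OF bounded_linear_inner_left] x')
    show "iter_differentiable_on k S (\<lambda>t. ?D b (x t))"
      using Suc.prems iter_differentiable_on_mono by (intro Suc.IH) auto
  qed
  ultimately show ?case by (rule iter_differentiable_on_SucI)
qed simp

lemma Ck_on_imp_iter_differentiable_on: "Ck_on k S f \<Longrightarrow> iter_differentiable_on k S f"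
proof (induction k arbitrary: f)
  case (Suc k)
  have "(f has_vector_derivative frechet_derivative f (at t within S) 1) (at t within S)"
    if "t \<in> S" for t
  proof -
    have D: "(f has_derivative frechet_derivative f (at t within S)) (at t within S)"
      using Suc.prems that
      unfolding Ck_on.simps differentiable_on_def frechet_derivative_works by blast
    have "frechet_derivative f (at t within S) h = h *\<^sub>R frechet_derivative f (at t within S) 1" for h
      using linear_scale[OF has_derivative_linear[OF D], of h 1] by simp
    then show ?thesis using D unfolding has_vector_derivative_def by (metis (no_types, lifting) ext)
  qed
  moreover have "iter_differentiable_on k S (\<lambda>t. frechet_derivative f (at t within S) 1)"
    using Suc by simp
  ultimately show ?case by (rule iter_differentiable_on_SucI)
qed simp

lemma differentiable_bounded_bilinear:
  "bounded_bilinear h \<Longrightarrow> f differentiable (at t within S) \<Longrightarrow> g differentiable (at t within S) \<Longrightarrow>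
    (\<lambda>t. h (f t) (g t)) differentiable (at t within S)"
  unfolding differentiable_def by (blast intro: bounded_bilinear.FDERIV)

text \<open>A connected set with more than one point has no isolated points. This makes derivatives
  within \<open>I\<close> unique, also at end points.\<close>

lemma at_within_interval_neq_bot:
  fixes I :: "real set"
  assumes "is_interval I" "interior I \<noteq> {}" "t \<in> I"
  shows "at t within I \<noteq> bot"
proof -
  have "I \<noteq> {y}" for y using assms(2) by auto
  then have "t islimpt I"
    using connected_imp_perfect[of I t] assms by (auto simp: is_interval_connected)
  then show ?thesis by (simp add: trivial_limit_within)
qed

section \<open>Gram matrices\<close>

lemma bounded_bilinear_matrix_vector_mult:
  "bounded_bilinear ((*v) :: real^'n^'m \<Rightarrow> real^'n \<Rightarrow> real^'m)"
  unfolding bilinear_conv_bounded_bilinear[symmetric] bilinear_def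
  by (auto intro!: linearI simp: matrix_vector_mult_add_rdistrib matrix_vector_right_distrib
      scaleR_matrix_vector_assoc matrix_vector_mult_scaleR)

lemma inner_matrix_vector_transpose: "v \<bullet> (transpose A *v w) = (A *v v) \<bullet> (w :: real^'n)"
  for A :: "real^'m^'n"
  by (metis dot_lmul_matrix inner_commute transpose_matrix_vector)

text \<open>Let \<open>E\<close> have the rows \<open>e1\<close>, \<open>e2\<close>,
  \<open>e3\<close>. Orthonormality says that \<open>E ** (g ** transpose E)\<close> is the
  identity. For square matrices the factors may be exchanged, and transposing gives
  \<open>transpose E ** (E ** g) = mat 1\<close>, which is the expansion.\<close>

lemma orthonormal_expansion:
  fixes g :: "real^3^3" and e1 e2 e3 v :: "real^3"
  assumes sym: "transpose g = g"
    and "e1 \<bullet> (g *v e1) = 1" "e2 \<bullet> (g *v e2) = 1" "e3 \<bullet> (g *v e3) = 1"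
    and "e1 \<bullet> (g *v e2) = 0" "e1 \<bullet> (g *v e3) = 0" "e2 \<bullet> (g *v e3) = 0"
  shows "v = (e1 \<bullet> (g *v v)) *\<^sub>R e1 + (e2 \<bullet> (g *v v)) *\<^sub>R e2 + (e3 \<bullet> (g *v v)) *\<^sub>R e3"
proof -
  define E :: "real^3^3" where "E = vector [e1, e2, e3]"
  have g_sym: "u \<bullet> (g *v w) = w \<bullet> (g *v u)" for u w
    by (metis inner_matrix_vector_transpose sym inner_commute)
  have Ev: "E *v w = vector [e1 \<bullet> w, e2 \<bullet> w, e3 \<bullet> w]" for w
    by (simp add: E_def vec_eq_iff forall_3 matrix_vector_mult_def inner_vec_def)
  have Etv: "transpose E *v w = (w$1) *\<^sub>R e1 + (w$2) *\<^sub>R e2 + (w$3) *\<^sub>R e3" for w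
    by (simp add: E_def vec_eq_iff matrix_vector_mult_def transpose_def sum_3 mult.commute)
  have "E ** (g ** transpose E) *v w = w" for w
    using assms(2-) g_sym[of e2 e1] g_sym[of e3 e1] g_sym[of e3 e2]
    by (simp add: matrix_vector_mul_assoc[symmetric] Etv Ev vec_eq_iff forall_3
        matrix_vector_right_distrib matrix_vector_mult_scaleR inner_add_right
        del: transpose_matrix_vector)
  then have "E ** (g ** transpose E) = mat 1"
    by (metis matrix_eq matrix_vector_mul_lid)
  then have "g ** transpose E ** E = mat 1"
    by (metis matrix_left_right_inverse)
  then have "transpose (g ** transpose E ** E) = mat 1" by (simp add: transpose_mat)
  then have "transpose E ** (E ** g) = mat 1"
    by (simp add: matrix_transpose_mul transpose_transpose sym)
  then have "v = transpose E *v (E *v (g *v v))"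
    by (metis matrix_vector_mul_assoc matrix_vector_mul_lid)
  then show ?thesis unfolding Ev Etv by simp
qed

section \<open>Curves in a Riemannian manifold\<close>

lemma tangent_space_add:
  "v \<in> tangent_space M p \<Longrightarrow> w \<in> tangent_space M p \<Longrightarrow> v + w \<in> tangent_space M p"
  unfolding tangent_space_def mem_Collect_eq plus_fun_apply
  by (metis add.right_neutral matrix_vector_right_distrib)

lemma tangent_space_tscale: "v \<in> tangent_space M p \<Longrightarrow> a *\<^sub>T v \<in> tangent_space M p"
  unfolding tangent_space_def mem_Collect_eq tscale_def
  by (metis matrix_vector_mult_scaleR scaleR_zero_right)

locale riemannian_curve =
  fixes M :: "'p riemannian" and I :: "real set" and \<gamma> :: "real \<Rightarrow> 'p"
  assumes manifold: "riemannian_3_manifold M"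
    and interval: "is_interval I" and interior_nonempty: "interior I \<noteq> {}"
    and curve: "smooth_curve M I \<gamma>"
begin

definition chart_times :: "'p chart \<Rightarrow> real set" where
  "chart_times c = {t \<in> I. \<gamma> t \<in> chart_dom c}"

definition gram :: "'p chart \<Rightarrow> real \<Rightarrow> real^3^3" where
  "gram c t = metric_tensor M c (chart_map c (\<gamma> t))"

text \<open>The connection form of the chart evaluated on the velocity: with C for this matrix, the
  covariant derivative along the curve reads V' + C V.\<close>

definition connection_matrix :: "'p chart \<Rightarrow> real \<Rightarrow> real^3^3" where
  "connection_matrix c t = (\<chi> k j. \<Sum>i\<in>UNIV.
     christoffel M c (chart_map c (\<gamma> t)) k i j * velocity M I \<gamma> t c $ i)"

section \<open>Localisation of the curve in a chart\<close>

lemma at_within_neq_bot: "t \<in> I \<Longrightarrow> at t within I \<noteq> bot"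
  using at_within_interval_neq_bot[OF interval interior_nonempty] .

lemma charts_at_iff: "t \<in> I \<Longrightarrow> c \<in> charts_at M (\<gamma> t) \<longleftrightarrow> c \<in> atlas M \<and> t \<in> chart_times c"
  by (auto simp: charts_at_def chart_times_def)

lemma chart_times_subset: "chart_times c \<subseteq> I"
  by (auto simp: chart_times_def)

lemma is_chart_atlas: "c \<in> atlas M \<Longrightarrow> is_chart (manifold_top M) c"
  using manifold by (simp add: riemannian_3_manifold_def smooth_atlas_def)

lemma open_chart_image: "c \<in> atlas M \<Longrightarrow> open (chart_map c ` chart_dom c)"
  using is_chart_atlas by (simp add: is_chart_def)

lemma charts_at_nonempty:
  assumes "t \<in> I"
  obtains c where "c \<in> charts_at M (\<gamma> t)"
proof -
  have "\<gamma> t \<in> topspace (manifold_top M)"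
    using curve assms by (auto simp: smooth_curve_def continuous_map_def)
  moreover have "(\<Union>c\<in>atlas M. chart_dom c) = topspace (manifold_top M)"
    using manifold unfolding riemannian_3_manifold_def smooth_atlas_def by blast
  ultimately obtain c where "c \<in> atlas M" "\<gamma> t \<in> chart_dom c" by blast
  then show ?thesis
    using that by (simp add: charts_at_def)
qed

text \<open>The preimage of an open chart domain under the continuous curve is relatively open in
  \<open>I\<close>, and derivatives are local.\<close>

lemma at_within_chart_times:
  assumes "c \<in> atlas M" "t \<in> chart_times c"
  shows "at t within chart_times c = at t within I"
proof -
  have "openin (manifold_top M) (chart_dom c)"
    using is_chart_atlas[OF assms(1)] by (simp add: is_chart_def)
  then have "openin (top_of_set I) (chart_times c)"
    using curve openin_continuous_map_preimage[of "top_of_set I" "manifold_top M" \<gamma>]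
    by (auto simp: smooth_curve_def chart_times_def)
  then obtain W where "open W" "chart_times c = I \<inter> W"
    by (auto simp: openin_open)
  then show ?thesis
    using assms(2) by (intro at_within_nhd[of t W]) auto
qed

text \<open>Serves to replace a function on \<open>I\<close> by a formula that is valid in one chart
  only.\<close>

lemma has_vector_derivative_chart_times:
  assumes "c \<in> atlas M" "t \<in> chart_times c"
    and "\<And>s. s \<in> chart_times c \<Longrightarrow> f s = h s"
    and "(f has_vector_derivative D) (at t within chart_times c)"
  shows "(h has_vector_derivative D) (at t within I)"
  unfolding at_within_chart_times[OF assms(1,2), symmetric]
  by (rule has_vector_derivative_transform[OF assms(2) _ assms(4)]) (simp add: assms(3))

lemma iter_differentiable_on_coordinates:
  assumes "c \<in> atlas M"
  shows "iter_differentiable_on k (chart_times c) (\<lambda>t. chart_map c (\<gamma> t))"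
  using Ck_on_imp_iter_differentiable_on[of k "chart_times c" "chart_map c \<circ> \<gamma>"] curve assms
  by (simp add: smooth_curve_def smooth_on_def chart_times_def o_def)

lemma has_vector_derivative_coordinates:
  assumes "c \<in> atlas M" "t \<in> chart_times c"
  shows "((\<lambda>t. chart_map c (\<gamma> t)) has_vector_derivative velocity M I \<gamma> t c) (at t within I)"
proof -
  obtain D where D: "((\<lambda>t. chart_map c (\<gamma> t)) has_vector_derivative D) (at t within I)"
    using iter_differentiable_on_coordinates[of c 1] assms at_within_chart_times[OF assms] by auto
  have "c \<in> charts_at M (\<gamma> t)"
    using assms chart_times_subset charts_at_iff by blast
  then show ?thesis
    using D by (auto simp: velocity_def o_def vector_derivative_works[symmetric] differentiableI_vector)
qed

lemma iter_differentiable_on_velocity: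
  assumes "c \<in> atlas M"
  shows "iter_differentiable_on k (chart_times c) (\<lambda>t. velocity M I \<gamma> t c)"
proof -
  obtain x' where x': "\<And>t. t \<in> chart_times c \<Longrightarrow>
      ((\<lambda>t. chart_map c (\<gamma> t)) has_vector_derivative x' t) (at t within chart_times c)"
    and iter: "iter_differentiable_on k (chart_times c) x'"
    using iter_differentiable_on_coordinates[OF assms, of "Suc k"] by auto
  \<comment> \<open>The witness \<open>x'\<close> is forced to be the velocity by uniqueness of
    derivatives within \<open>I\<close>.\<close>
  have "x' t = velocity M I \<gamma> t c" if "t \<in> chart_times c" for t
    using x'[OF that] has_vector_derivative_coordinates[OF assms that]
      at_within_chart_times[OF assms that] at_within_neq_bot chart_times_subset that
    by (metis subsetD vector_derivative_within)
  then show ?thesis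
    by (rule iter_differentiable_on_transform[OF iter])
qed

section \<open>The metric and its Christoffel symbols along the curve\<close>

lemma Ck_on_metric_tensor: "c \<in> atlas M \<Longrightarrow> Ck_on k (chart_map c ` chart_dom c) (metric_tensor M c)"
  using manifold by (simp add: riemannian_3_manifold_def smooth_on_def)

lemma gram_symmetric: "c \<in> atlas M \<Longrightarrow> t \<in> chart_times c \<Longrightarrow> transpose (gram c t) = gram c t"
  using manifold by (auto simp: riemannian_3_manifold_def gram_def chart_times_def)

lemma iter_differentiable_on_gram:
  "c \<in> atlas M \<Longrightarrow> iter_differentiable_on k (chart_times c) (gram c)"
  unfolding gram_def
  by (rule iter_differentiable_on_compose[OF open_chart_image _ Ck_on_metric_tensor
        iter_differentiable_on_coordinates]) (auto simp: chart_times_def)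

lemma iter_differentiable_on_metric_deriv:
  assumes "c \<in> atlas M"
  shows "iter_differentiable_on k (chart_times c) (\<lambda>t. metric_deriv M c (chart_map c (\<gamma> t)) l i j)"
proof -
  let ?U = "chart_map c ` chart_dom c"
  let ?D = "\<lambda>y. frechet_derivative (metric_tensor M c) (at y within ?U) (axis l 1)"
  have D: "Ck_on k ?U ?D"
    using Ck_on_metric_tensor[OF assms, of "Suc k"] by simp
  have "iter_differentiable_on k (chart_times c) (\<lambda>t. ?D (chart_map c (\<gamma> t)))"
    by (rule iter_differentiable_on_compose[OF open_chart_image[OF assms] _ D
          iter_differentiable_on_coordinates[OF assms]]) (auto simp: chart_times_def)
  then have "iter_differentiable_on k (chart_times c) (\<lambda>t. ?D (chart_map c (\<gamma> t)) $ i $ j)"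
    by (intro iter_differentiable_on_bounded_linear[OF bounded_linear_vec_nth])
  moreover have "?D (chart_map c (\<gamma> t)) $ i $ j = metric_deriv M c (chart_map c (\<gamma> t)) l i j"
    if "t \<in> chart_times c" for t
    using that at_within_open[OF _ open_chart_image[OF assms], of "chart_map c (\<gamma> t)"]
    by (simp add: metric_deriv_def chart_times_def)
  ultimately show ?thesis
    by (rule iter_differentiable_on_transform)
qed

lemma christoffel_levi_civita:
  assumes "c \<in> atlas M" "t \<in> chart_times c"
  shows "levi_civita_at M c (chart_map c (\<gamma> t)) (christoffel M c (chart_map c (\<gamma> t)))"
  using assms levi_civita_at_iff[OF manifold assms(1)] by (simp add: chart_times_def)

text \<open>By the chain rule the derivative is the sum of the partial derivatives of the metric
  weighted with the velocity. Metric compatibility of the Christoffel symbols rewrites each of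
  these.\<close>

lemma has_vector_derivative_gram:
  assumes "c \<in> atlas M" "t \<in> chart_times c"
  shows "(gram c has_vector_derivative
    transpose (connection_matrix c t) ** gram c t + gram c t ** connection_matrix c t) (at t within I)"
proof -
  let ?x = "chart_map c (\<gamma> t)" and ?v = "velocity M I \<gamma> t c"
  let ?F = "frechet_derivative (metric_tensor M c) (at ?x)"
  have D: "(metric_tensor M c has_derivative ?F) (at ?x)"
    using assms by (intro Ck_on_Suc_has_derivative[OF Ck_on_metric_tensor open_chart_image])
      (auto simp: chart_times_def)
  have "?F ?v = transpose (connection_matrix c t) ** gram c t + gram c t ** connection_matrix c t"
  proof (simp add: vec_eq_iff, intro allI)
    fix i j
    have "?F ?v = ?F (\<Sum>k\<in>UNIV. ?v $ k *\<^sub>R axis k 1)"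
      using basis_expansion[of ?v] by (simp add: scalar_mult_eq_scaleR)
    also have "\<dots> = (\<Sum>k\<in>UNIV. ?v $ k *\<^sub>R ?F (axis k 1))"
      using has_derivative_linear[OF D] by (simp add: linear_sum linear_scale)
    finally have "?F ?v $ i $ j = (\<Sum>k\<in>UNIV. ?v $ k * metric_deriv M c ?x k i j)"
      by (simp add: metric_deriv_def)
    also have "\<dots> = (\<Sum>k\<in>UNIV. \<Sum>l\<in>UNIV. christoffel M c ?x l k i * ?v $ k * gram c t $ l $ j)
        + (\<Sum>k\<in>UNIV. \<Sum>l\<in>UNIV. gram c t $ i $ l * (christoffel M c ?x l k j * ?v $ k))"
      using christoffel_levi_civita[OF assms] unfolding levi_civita_at_def gram_def
      by (simp add: sum.distrib[symmetric] sum_distrib_left distrib_left mult_ac)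
    also have "\<dots> = (transpose (connection_matrix c t) ** gram c t) $ i $ j
        + (gram c t ** connection_matrix c t) $ i $ j"
      by (subst (1 2) sum.swap) (simp add: connection_matrix_def matrix_matrix_mult_def
          transpose_def sum_distrib_left sum_distrib_right)
    finally show "?F ?v $ i $ j = (transpose (connection_matrix c t) ** gram c t) $ i $ j
        + (gram c t ** connection_matrix c t) $ i $ j" .
  qed
  then show ?thesis
    using has_vector_derivative_compose_within[OF has_vector_derivative_coordinates[OF assms] D]
    by (simp add: gram_def[abs_def])
qed

text \<open>Lowering the index of the Christoffel symbols removes the inverse matrix from them.\<close>

lemma gram_connection_matrix_nth:
  assumes c: "c \<in> atlas M" "t \<in> chart_times c"
  shows "(gram c t ** connection_matrix c t) $ m $ j = (\<Sum>i\<in>UNIV.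
    (1/2) * (metric_deriv M c (chart_map c (\<gamma> t)) i j m + metric_deriv M c (chart_map c (\<gamma> t)) j i m
      - metric_deriv M c (chart_map c (\<gamma> t)) m i j) * velocity M I \<gamma> t c $ i)"
proof -
  let ?x = "chart_map c (\<gamma> t)"
  define L where "L m i j = (\<Sum>l\<in>UNIV. gram c t $ m $ l * christoffel M c ?x l i j)" for m i j
  have g: "gram c t $ i $ j = gram c t $ j $ i" for i j
    using arg_cong[OF gram_symmetric[OF c], of "\<lambda>A. A $ j $ i"] by (simp add: transpose_def)
  have L_sym: "L m i j = L m j i" for m i j
    using christoffel_levi_civita[OF c] unfolding L_def levi_civita_at_def by metis
  have "metric_deriv M c ?x k i j = L j k i + L i k j" for k i j
  proof -
    have "metric_deriv M c ?x k i j = (\<Sum>l\<in>UNIV. christoffel M c ?x l k i * gram c t $ l $ j)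
        + (\<Sum>l\<in>UNIV. christoffel M c ?x l k j * gram c t $ i $ l)"
      using christoffel_levi_civita[OF c] unfolding levi_civita_at_def gram_def by blast
    then show ?thesis
      unfolding L_def by (subst (asm) g[of _ j]) (simp add: mult.commute)
  qed
  \<comment> \<open>Koszul's argument: of the six terms that the three derivatives produce, four
    cancel in pairs by the symmetry of \<open>L\<close> in its last two indices, and the other two
    are equal.\<close>
  then have "L m i j = (1/2) * (metric_deriv M c ?x i j m + metric_deriv M c ?x j i m
      - metric_deriv M c ?x m i j)" for i
    using L_sym[of i m j] L_sym[of j m i] L_sym[of m j i] by simp
  moreover have "(gram c t ** connection_matrix c t) $ m $ j = (\<Sum>i\<in>UNIV. L m i j * velocity M I \<gamma> t c $ i)"
    unfolding L_def
    by (simp add: connection_matrix_def matrix_matrix_mult_def sum_distrib_left sum_distrib_right mult.assoc)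
      (rule sum.swap)
  ultimately show ?thesis by presburger
qed

text \<open>Avoids differentiating a matrix inverse: later on, the connection matrix is
  differentiated only as part of this product.\<close>

lemma iter_differentiable_on_gram_connection_matrix:
  assumes "c \<in> atlas M"
  shows "iter_differentiable_on k (chart_times c) (\<lambda>t. gram c t ** connection_matrix c t)"
proof -
  note bl = iter_differentiable_on_bounded_linear
  let ?d = "\<lambda>l i j t. metric_deriv M c (chart_map c (\<gamma> t)) l i j"
  have "iter_differentiable_on k (chart_times c) (\<lambda>t. \<chi> m j. \<Sum>i\<in>UNIV.
      (1/2) * (?d i j m t + ?d j i m t - ?d m i j t) * velocity M I \<gamma> t c $ i)"
    unfolding diff_conv_add_uminus
    by (intro iter_differentiable_on_vec_lambda iter_differentiable_on_sum
        iter_differentiable_on_bounded_bilinear[OF bounded_bilinear_mult]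
        iter_differentiable_on_add iter_differentiable_on_const
        bl[OF bounded_linear_minus[OF bounded_linear_ident]]
        iter_differentiable_on_metric_deriv bl[OF bounded_linear_vec_nth]
        iter_differentiable_on_velocity assms)
  then show ?thesis
  proof (rule iter_differentiable_on_transform)
    fix t assume "t \<in> chart_times c"
    then show "(\<chi> m j. \<Sum>i\<in>UNIV. (1/2) * (?d i j m t + ?d j i m t - ?d m i j t) * velocity M I \<gamma> t c $ i)
        = gram c t ** connection_matrix c t"
      using gram_connection_matrix_nth[OF assms] by (simp add: vec_eq_iff)
  qed
qed

section \<open>The covariant derivative in a chart and its compatibility with the metric\<close>

lemma cov_deriv_chart:
  assumes "c \<in> charts_at M (\<gamma> t)"
  shows "cov_deriv M I \<gamma> V t c =
    vector_derivative (\<lambda>s. V s c) (at t within I) + connection_matrix c t *v V t c"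
proof -
  have "(\<Sum>i\<in>UNIV. \<Sum>j\<in>UNIV. christoffel M c (chart_map c (\<gamma> t)) k i j *
      velocity M I \<gamma> t c $ i * V t c $ j) = (connection_matrix c t *v V t c) $ k" for k
    by (simp add: connection_matrix_def matrix_vector_mult_def sum_distrib_right)
      (rule sum.swap)
  then show ?thesis using assms by (simp add: cov_deriv_def vec_eq_iff)
qed

lemma vector_field_has_derivative:
  assumes "vector_field_along M I \<gamma> V" "t \<in> I" "c \<in> charts_at M (\<gamma> t)"
  shows "((\<lambda>s. V s c) has_vector_derivative
    cov_deriv M I \<gamma> V t c - connection_matrix c t *v V t c) (at t within I)"
  using assms by (simp add: cov_deriv_chart vector_field_along_def vector_derivative_works)

text \<open>Moving the transition matrix A from both vectors to the metric g gives A^T g A, which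
  the transformation law of the metric identifies with the metric in the other chart.\<close>

lemma rinner_chart:
  assumes c: "c \<in> charts_at M p" and v: "v \<in> tangent_space M p" and w: "w \<in> tangent_space M p"
  shows "rinner M p v w = v c \<bullet> (metric_tensor M c (chart_map c p) *v w c)"
proof -
  define d where "d = (SOME c. c \<in> charts_at M p)"
  have d: "d \<in> charts_at M p" unfolding d_def using c by (rule someI)
  let ?A = "transition_matrix c d p" and ?g = "metric_tensor M d (chart_map d p)"
  have "rinner M p v w = v d \<bullet> (?g *v w d)"
    by (simp add: rinner_def d_def Let_def)
  moreover have "v d = ?A *v v c" "w d = ?A *v w c"
    using v w c d unfolding tangent_space_def by blast+
  ultimately have "rinner M p v w = (?A *v v c) \<bullet> (?g *v (?A *v w c))"
    by simp
  also have "\<dots> = v c \<bullet> ((transpose ?A ** ?g ** ?A) *v w c)"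
    by (simp add: inner_matrix_vector_transpose[symmetric] matrix_vector_mul_assoc[symmetric]
        del: transpose_matrix_vector)
  also have "transpose ?A ** ?g ** ?A = metric_tensor M c (chart_map c p)"
    using manifold c d unfolding riemannian_3_manifold_def by metis
  finally show ?thesis .
qed

text \<open>The chart that \<^const>\<open>rinner\<close> chooses at \<open>\<gamma> t\<close> works near \<open>t\<close>, so the transformation law of the
  covariant derivative is not needed.\<close>

lemma rinner_has_derivative:
  assumes V: "vector_field_along M I \<gamma> V" and W: "vector_field_along M I \<gamma> W" and t: "t \<in> I"
  shows "((\<lambda>s. rinner M (\<gamma> s) (V s) (W s)) has_real_derivative
    rinner M (\<gamma> t) (cov_deriv M I \<gamma> V t) (W t) + rinner M (\<gamma> t) (V t) (cov_deriv M I \<gamma> W t))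
    (at t within I)"
proof -
  define c where "c = (SOME c. c \<in> charts_at M (\<gamma> t))"
  have c: "c \<in> charts_at M (\<gamma> t)"
    unfolding c_def using charts_at_nonempty[OF t] by (metis someI)
  then have ct: "c \<in> atlas M" "t \<in> chart_times c" using t charts_at_iff by auto
  let ?g = "gram c t" and ?C = "connection_matrix c t"
  have inner: "rinner M (\<gamma> t) v w = v c \<bullet> (?g *v w c)" for v w
    by (simp add: rinner_def c_def gram_def Let_def)
  have "((\<lambda>s. V s c \<bullet> (gram c s *v W s c)) has_vector_derivative
      V t c \<bullet> (?g *v (cov_deriv M I \<gamma> W t c - ?C *v W t c) + (transpose ?C ** ?g + ?g ** ?C) *v W t c)
      + (cov_deriv M I \<gamma> V t c - ?C *v V t c) \<bullet> (?g *v W t c)) (at t within I)"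
    by (intro bounded_bilinear.has_vector_derivative[OF bounded_bilinear_inner]
        bounded_bilinear.has_vector_derivative[OF bounded_bilinear_matrix_vector_mult]
        vector_field_has_derivative has_vector_derivative_gram V W t c ct)
  \<comment> \<open>The two summands in the derivative of the Gram matrix cancel the terms with
    \<open>?C\<close> that come from the derivatives of the components of \<open>V\<close> and
    \<open>W\<close>.\<close>
  also have "V t c \<bullet> (?g *v (cov_deriv M I \<gamma> W t c - ?C *v W t c) + (transpose ?C ** ?g + ?g ** ?C) *v W t c)
      + (cov_deriv M I \<gamma> V t c - ?C *v V t c) \<bullet> (?g *v W t c)
    = rinner M (\<gamma> t) (cov_deriv M I \<gamma> V t) (W t) + rinner M (\<gamma> t) (V t) (cov_deriv M I \<gamma> W t)"
    unfolding inner
    by (simp add: matrix_vector_mult_diff_distrib matrix_vector_mult_add_rdistrib inner_add_right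
        inner_diff_left inner_diff_right matrix_vector_mul_assoc[symmetric]
        inner_matrix_vector_transpose del: transpose_matrix_vector)
  finally have "((\<lambda>s. V s c \<bullet> (gram c s *v W s c)) has_vector_derivative
      rinner M (\<gamma> t) (cov_deriv M I \<gamma> V t) (W t) + rinner M (\<gamma> t) (V t) (cov_deriv M I \<gamma> W t))
      (at t within chart_times c)"
    using at_within_chart_times[OF ct] by simp
  \<comment> \<open>At times other than \<open>t\<close>, \<open>rinner\<close> may choose a chart
    different from \<open>c\<close>; chart independence brings its value back to
    \<open>c\<close>.\<close>
  moreover have "V s c \<bullet> (gram c s *v W s c) = rinner M (\<gamma> s) (V s) (W s)" if "s \<in> chart_times c" for s
    unfolding gram_def using that ct V W charts_at_iff chart_times_subset
    unfolding vector_field_along_def by (intro rinner_chart[symmetric]) blast+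
  ultimately show ?thesis
    unfolding has_real_derivative_iff_has_vector_derivative
    by (intro has_vector_derivative_chart_times[OF ct])
qed

section \<open>Sums and multiples of fields along the curve\<close>

lemma vector_field_along_add:
  "vector_field_along M I \<gamma> V \<Longrightarrow> vector_field_along M I \<gamma> W \<Longrightarrow>
   vector_field_along M I \<gamma> (\<lambda>t. V t + W t)"
  unfolding vector_field_along_def
  by (auto intro!: tangent_space_add differentiable_add)

lemma vector_field_along_tscale:
  assumes "vector_field_along M I \<gamma> V" "\<And>t. t \<in> I \<Longrightarrow> a differentiable (at t within I)"
  shows "vector_field_along M I \<gamma> (\<lambda>t. a t *\<^sub>T V t)"
  unfolding vector_field_along_def
proof (intro ballI conjI)
  fix t c assume t: "t \<in> I"
  show "a t *\<^sub>T V t \<in> tangent_space M (\<gamma> t)"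
    using assms(1) t by (intro tangent_space_tscale) (simp add: vector_field_along_def)
  assume "c \<in> charts_at M (\<gamma> t)"
  then show "(\<lambda>s. (a s *\<^sub>T V s) c) differentiable (at t within I)"
    using assms t unfolding tscale_def vector_field_along_def by (intro differentiable_scaleR) auto
qed

lemma cov_deriv_add:
  assumes V: "vector_field_along M I \<gamma> V" and W: "vector_field_along M I \<gamma> W" and t: "t \<in> I"
  shows "cov_deriv M I \<gamma> (\<lambda>t. V t + W t) t = cov_deriv M I \<gamma> V t + cov_deriv M I \<gamma> W t"
proof
  fix c
  show "cov_deriv M I \<gamma> (\<lambda>t. V t + W t) t c = (cov_deriv M I \<gamma> V t + cov_deriv M I \<gamma> W t) c"
  proof (cases "c \<in> charts_at M (\<gamma> t)")
    case True
    have "((\<lambda>s. V s c + W s c) has_vector_derivative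
        (cov_deriv M I \<gamma> V t c - connection_matrix c t *v V t c) +
        (cov_deriv M I \<gamma> W t c - connection_matrix c t *v W t c)) (at t within I)"
      by (intro has_vector_derivative_add vector_field_has_derivative V W t True)
    from vector_derivative_within[OF at_within_neq_bot[OF t] this] show ?thesis
      by (simp add: cov_deriv_chart[OF True, of "\<lambda>t. V t + W t"] matrix_vector_right_distrib)
  qed (simp add: cov_deriv_def)
qed

lemma cov_deriv_tscale:
  assumes V: "vector_field_along M I \<gamma> V" and a: "(a has_real_derivative a') (at t within I)" and t: "t \<in> I"
  shows "cov_deriv M I \<gamma> (\<lambda>t. a t *\<^sub>T V t) t = a' *\<^sub>T V t + a t *\<^sub>T cov_deriv M I \<gamma> V t"
proof
  fix c
  show "cov_deriv M I \<gamma> (\<lambda>t. a t *\<^sub>T V t) t c = (a' *\<^sub>T V t + a t *\<^sub>T cov_deriv M I \<gamma> V t) c"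
  proof (cases "c \<in> charts_at M (\<gamma> t)")
    case True
    have "((\<lambda>s. a s *\<^sub>R V s c) has_vector_derivative
        a t *\<^sub>R (cov_deriv M I \<gamma> V t c - connection_matrix c t *v V t c) + a' *\<^sub>R V t c) (at t within I)"
      by (intro has_vector_derivative_scaleR vector_field_has_derivative V a t True)
    from vector_derivative_within[OF at_within_neq_bot[OF t] this] show ?thesis
      unfolding cov_deriv_chart[OF True, of "\<lambda>t. a t *\<^sub>T V t"]
      by (simp add: tscale_def matrix_vector_mult_scaleR scaleR_diff_right)
  next
    case False
    \<comment> \<open>Away from the charts at \<gamma> t the covariant derivatives are 0 by
      definition. The term with \<open>a'\<close> vanishes too, because components of tangent
      vectors are 0 there.\<close>
    then have "V t c = 0"
      using V t unfolding vector_field_along_def tangent_space_def by blast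
    then show ?thesis
      using False by (simp add: cov_deriv_def tscale_def)
  qed
qed

end

section \<open>Frenet curves\<close>

lemma (in riemannian_curve) differentiable_chart_times:
  assumes "c \<in> atlas M" "t \<in> chart_times c"
    and "\<And>s. s \<in> chart_times c \<Longrightarrow> f s = h s"
    and "f differentiable (at t within I)"
  shows "h differentiable (at t within I)"
proof -
  have "(f has_vector_derivative vector_derivative f (at t within I)) (at t within chart_times c)"
    using assms(4) by (simp add: at_within_chart_times[OF assms(1,2)] vector_derivative_works)
  then show ?thesis
    by (intro differentiableI_vector has_vector_derivative_chart_times[OF assms(1-3)])
qed

lemma (in riemannian_curve) iter_differentiable_on_imp_differentiable:
  assumes "c \<in> atlas M" "t \<in> chart_times c" "iter_differentiable_on 1 (chart_times c) f"
  shows "f differentiable (at t within I)"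
  using assms(3) assms(2) unfolding at_within_chart_times[OF assms(1,2), symmetric] One_nat_def
    iter_differentiable_on.simps(2)
  by (blast intro: differentiableI_vector)

section \<open>Bilinearity of the inner product\<close>

lemma rinner_add_left: "rinner M p (u + v) w = rinner M p u w + rinner M p v w"
  by (simp add: rinner_def Let_def inner_add_left)

lemma rinner_add_right: "rinner M p u (v + w) = rinner M p u v + rinner M p u w"
  by (simp add: rinner_def Let_def inner_add_right matrix_vector_right_distrib)

lemma rinner_tscale_left: "rinner M p (a *\<^sub>T v) w = a * rinner M p v w"
  by (simp add: rinner_def Let_def tscale_def)

lemma rinner_tscale_right: "rinner M p v (a *\<^sub>T w) = a * rinner M p v w"
  by (simp add: rinner_def Let_def tscale_def matrix_vector_mult_scaleR)

lemma rinner_zero_left: "rinner M p 0 w = 0"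
  by (simp add: rinner_def Let_def)

lemma rinner_zero_right: "rinner M p v 0 = 0"
  by (simp add: rinner_def Let_def)

lemmas rinner_bilinear = rinner_add_left rinner_add_right rinner_tscale_left rinner_tscale_right
  rinner_zero_left rinner_zero_right

locale frenet_curve = riemannian_curve M I \<gamma>
  for M :: "'p riemannian" and I :: "real set" and \<gamma> :: "real \<Rightarrow> 'p" +
  fixes \<omega> :: "real \<Rightarrow> 'p chart \<Rightarrow> real" and \<kappa> \<tau> :: "real \<Rightarrow> real"
    and T N B :: "real \<Rightarrow> 'p tangent"
  assumes frenet: "frenet_frame M I \<gamma> \<omega> \<kappa> \<tau> T N B"
    and curvature_pos: "\<And>t. t \<in> I \<Longrightarrow> \<kappa> t > 0"
begin

abbreviation rho :: "real \<Rightarrow> real" where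
  "rho t \<equiv> sqrt ((\<tau> t)\<^sup>2 + (\<kappa> t)\<^sup>2)"

section \<open>The Frenet frame as an orthonormal basis\<close>

lemma frame_fields: "vector_field_along M I \<gamma> T" "vector_field_along M I \<gamma> N" "vector_field_along M I \<gamma> B"
  using frenet by (simp_all add: frenet_frame_def)

lemma frame_tangent:
  "t \<in> I \<Longrightarrow> T t \<in> tangent_space M (\<gamma> t)" "t \<in> I \<Longrightarrow> N t \<in> tangent_space M (\<gamma> t)"
  "t \<in> I \<Longrightarrow> B t \<in> tangent_space M (\<gamma> t)"
  using frame_fields by (simp_all add: vector_field_along_def)

lemma frenet_equations:
  assumes "t \<in> I"
  shows "cov_deriv M I \<gamma> T t = \<kappa> t *\<^sub>T N t"
    and "cov_deriv M I \<gamma> N t = (- \<kappa> t) *\<^sub>T T t + \<tau> t *\<^sub>T B t"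
    and "cov_deriv M I \<gamma> B t = (- \<tau> t) *\<^sub>T N t"
  using frenet assms by (simp_all add: frenet_frame_def)

lemma rinner_commute:
  assumes t: "t \<in> I" and v: "v \<in> tangent_space M (\<gamma> t)" and w: "w \<in> tangent_space M (\<gamma> t)"
  shows "rinner M (\<gamma> t) v w = rinner M (\<gamma> t) w v"
proof -
  obtain c where c: "c \<in> charts_at M (\<gamma> t)" using charts_at_nonempty[OF t] .
  then have "transpose (gram c t) = gram c t"
    using gram_symmetric t charts_at_iff by blast
  then show ?thesis
    unfolding rinner_chart[OF c v w] rinner_chart[OF c w v] gram_def[symmetric]
    by (metis inner_matrix_vector_transpose inner_commute)
qed

lemma frame_orthonormal:
  assumes "t \<in> I"
  shows "rinner M (\<gamma> t) (T t) (T t) = 1" "rinner M (\<gamma> t) (N t) (N t) = 1" "rinner M (\<gamma> t) (B t) (B t) = 1"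
    and "rinner M (\<gamma> t) (T t) (N t) = 0" "rinner M (\<gamma> t) (T t) (B t) = 0" "rinner M (\<gamma> t) (N t) (B t) = 0"
    and "rinner M (\<gamma> t) (N t) (T t) = 0" "rinner M (\<gamma> t) (B t) (T t) = 0" "rinner M (\<gamma> t) (B t) (N t) = 0"
proof -
  show *: "rinner M (\<gamma> t) (T t) (T t) = 1" "rinner M (\<gamma> t) (N t) (N t) = 1" "rinner M (\<gamma> t) (B t) (B t) = 1"
    "rinner M (\<gamma> t) (T t) (N t) = 0" "rinner M (\<gamma> t) (T t) (B t) = 0" "rinner M (\<gamma> t) (N t) (B t) = 0"
    using frenet assms unfolding frenet_frame_def rnorm_def real_sqrt_eq_1_iff by blast+
  show "rinner M (\<gamma> t) (N t) (T t) = 0" "rinner M (\<gamma> t) (B t) (T t) = 0" "rinner M (\<gamma> t) (B t) (N t) = 0"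
    using * rinner_commute[OF assms] frame_tangent[OF assms] by metis+
qed

lemma frame_chart:
  assumes "c \<in> atlas M" "t \<in> chart_times c"
  shows "T t c \<bullet> (gram c t *v T t c) = 1" "N t c \<bullet> (gram c t *v N t c) = 1" "B t c \<bullet> (gram c t *v B t c) = 1"
    and "T t c \<bullet> (gram c t *v N t c) = 0" "T t c \<bullet> (gram c t *v B t c) = 0" "N t c \<bullet> (gram c t *v B t c) = 0"
    and "N t c \<bullet> (gram c t *v T t c) = 0" "B t c \<bullet> (gram c t *v T t c) = 0" "B t c \<bullet> (gram c t *v N t c) = 0"
proof -
  have t: "t \<in> I" and c: "c \<in> charts_at M (\<gamma> t)"
    using assms chart_times_subset charts_at_iff by blast+
  note r = rinner_chart[OF c, folded gram_def]
  show "T t c \<bullet> (gram c t *v T t c) = 1" "N t c \<bullet> (gram c t *v N t c) = 1" "B t c \<bullet> (gram c t *v B t c) = 1"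
    and "T t c \<bullet> (gram c t *v N t c) = 0" "T t c \<bullet> (gram c t *v B t c) = 0" "N t c \<bullet> (gram c t *v B t c) = 0"
    and "N t c \<bullet> (gram c t *v T t c) = 0" "B t c \<bullet> (gram c t *v T t c) = 0" "B t c \<bullet> (gram c t *v N t c) = 0"
    using frame_orthonormal[OF t] frame_tangent[OF t] by (simp_all add: r)
qed

lemma frame_expansion:
  assumes t: "t \<in> I" and v: "v \<in> tangent_space M (\<gamma> t)"
  shows "v = rinner M (\<gamma> t) (T t) v *\<^sub>T T t + rinner M (\<gamma> t) (N t) v *\<^sub>T N t
    + rinner M (\<gamma> t) (B t) v *\<^sub>T B t"
proof
  fix c
  show "v c = (rinner M (\<gamma> t) (T t) v *\<^sub>T T t + rinner M (\<gamma> t) (N t) v *\<^sub>T N t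
    + rinner M (\<gamma> t) (B t) v *\<^sub>T B t) c"
  proof (cases "c \<in> charts_at M (\<gamma> t)")
    case True
    then have c: "c \<in> atlas M" "t \<in> chart_times c" using t charts_at_iff by auto
    note r = rinner_chart[OF True _ v, folded gram_def]
    show ?thesis
      using orthonormal_expansion[OF gram_symmetric[OF c] frame_chart(1-6)[OF c], of "v c"]
      by (simp add: tscale_def r frame_tangent[OF t])
  next
    case False
    then have "v c = 0" "T t c = 0" "N t c = 0" "B t c = 0"
      using v frame_tangent[OF t] unfolding tangent_space_def by blast+
    then show ?thesis by (simp add: tscale_def)
  qed
qed

lemma rinner_frame_combination:
  assumes "t \<in> I"
  defines "v \<equiv> \<lambda>a n b. a *\<^sub>T T t + n *\<^sub>T N t + b *\<^sub>T B t"
  shows "rinner M (\<gamma> t) (N t) (v a n b) = n"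
    and "rinner M (\<gamma> t) (v a n b) (v a n b) = a\<^sup>2 + n\<^sup>2 + b\<^sup>2"
  unfolding v_def
  by (simp_all add: rinner_bilinear frame_orthonormal[OF assms(1)] power2_eq_square)

lemma rho_pos: "t \<in> I \<Longrightarrow> rho t > 0"
  using curvature_pos[of t] by (simp add: add_nonneg_pos)

section \<open>Differentiability of curvature and torsion\<close>

lemma curvature_torsion_differentiable_chart:
  assumes c: "c \<in> atlas M" "t \<in> chart_times c"
  shows "\<kappa> differentiable (at t within I)" and "\<tau> differentiable (at t within I)"
proof -
  let ?J = "chart_times c"
  let ?g = "gram c" and ?C = "connection_matrix c"
  have JI: "s \<in> I" and ch: "c \<in> charts_at M (\<gamma> s)" if "s \<in> ?J" for s
    using that c(1) chart_times_subset charts_at_iff by blast+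
  \<comment> \<open>Three derivatives of the velocity are used: one yields \<open>x2\<close>, the
    second enters \<open>A'\<close>, and the third makes \<open>A'\<close> differentiable.\<close>
  obtain x2 where x2: "\<And>s. s \<in> ?J \<Longrightarrow>
      ((\<lambda>t. velocity M I \<gamma> t c) has_vector_derivative x2 s) (at s within ?J)"
    and x2_iter: "iter_differentiable_on (Suc 1) ?J x2"
    using iter_differentiable_on_velocity[OF c(1), of "Suc (Suc 1)"]
    unfolding iter_differentiable_on.simps(2) by blast
  define A where "A s = ?g s *v x2 s + (?g s ** ?C s) *v velocity M I \<gamma> s c" for s
  \<comment> \<open>By the first Frenet equation, \<open>A\<close> is \<kappa> N with its index
    lowered.\<close>
  have A_eq: "A s = ?g s *v (\<kappa> s *\<^sub>R N s c)" if s: "s \<in> ?J" for s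
  proof -
    have T_eq: "T s c = velocity M I \<gamma> s c" if "s \<in> ?J" for s
      using frenet JI[OF that] by (simp add: frenet_frame_def)
    have "((\<lambda>s. T s c) has_vector_derivative x2 s) (at s within I)"
      by (rule has_vector_derivative_chart_times[OF c(1) s _ x2[OF s]]) (simp add: T_eq)
    from vector_derivative_unique_within[OF at_within_neq_bot[OF JI[OF s]] this
        vector_field_has_derivative[OF frame_fields(1) JI[OF s] ch[OF s]]]
    have "x2 s = \<kappa> s *\<^sub>R N s c - ?C s *v T s c"
      using frenet_equations(1)[OF JI[OF s]] by (simp add: tscale_def)
    then show ?thesis
      unfolding A_def T_eq[OF s, symmetric]
      by (simp add: matrix_vector_mult_diff_distrib matrix_vector_mul_assoc[symmetric])
  qed
  have "iter_differentiable_on (Suc 1) ?J A"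
    unfolding A_def
    by (intro iter_differentiable_on_add iter_differentiable_on_gram iter_differentiable_on_velocity
        iter_differentiable_on_bounded_bilinear[OF bounded_bilinear_matrix_vector_mult]
        iter_differentiable_on_gram_connection_matrix c x2_iter)
  then obtain A' where A': "\<And>s. s \<in> ?J \<Longrightarrow> (A has_vector_derivative A' s) (at s within ?J)"
    and A'_iter: "iter_differentiable_on 1 ?J A'"
    unfolding iter_differentiable_on.simps(2) by blast
  have diff: "(\<lambda>s. X s c) differentiable (at s within I)"
    if "vector_field_along M I \<gamma> X" "s \<in> ?J" for X s
    using that JI ch by (simp add: vector_field_along_def)
  have \<kappa>: "\<kappa> differentiable (at s within I)" if s: "s \<in> ?J" for s
  proof (rule differentiable_chart_times[OF c(1) s])
    \<comment> \<open>Both factors are differentiable: \<open>N\<close> as a field along the curve,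
      \<open>A\<close> as an expression in the smooth data of the curve and the metric.\<close>
    show "N s c \<bullet> A s = \<kappa> s" if "s \<in> ?J" for s
      by (simp add: A_eq[OF that] matrix_vector_mult_scaleR frame_chart[OF c(1) that])
    have "A differentiable (at s within I)"
      using A'[OF s] unfolding at_within_chart_times[OF c(1) s] by (rule differentiableI_vector)
    then show "(\<lambda>s. N s c \<bullet> A s) differentiable (at s within I)"
      by (rule differentiable_bounded_bilinear[OF bounded_bilinear_inner diff[OF frame_fields(2) s]])
  qed
  then show "\<kappa> differentiable (at t within I)" using c by blast
  show "\<tau> differentiable (at t within I)"
  proof (rule differentiable_chart_times[OF c])
    fix s assume s: "s \<in> ?J"
    obtain k' where k': "(\<kappa> has_real_derivative k') (at s within I)"
      using \<kappa>[OF s] by (auto simp: real_differentiable_def)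
    \<comment> \<open>A second computation of the derivative of \<open>A\<close>, now by the product
      rule on \<kappa> g N, possible since \<kappa> is known to be differentiable.\<close>
    have D: "((\<lambda>s. ?g s *v (\<kappa> s *\<^sub>R N s c)) has_vector_derivative
        ?g s *v (\<kappa> s *\<^sub>R (cov_deriv M I \<gamma> N s c - ?C s *v N s c) + k' *\<^sub>R N s c)
        + (transpose (?C s) ** ?g s + ?g s ** ?C s) *v (\<kappa> s *\<^sub>R N s c)) (at s within I)"
      by (intro bounded_bilinear.has_vector_derivative[OF bounded_bilinear_matrix_vector_mult]
          has_vector_derivative_scaleR k' vector_field_has_derivative has_vector_derivative_gram
          frame_fields s c JI ch)
    have "((\<lambda>s. ?g s *v (\<kappa> s *\<^sub>R N s c)) has_vector_derivative A' s) (at s within I)"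
      by (rule has_vector_derivative_chart_times[OF c(1) s A_eq A'[OF s]])
    from vector_derivative_unique_within[OF at_within_neq_bot[OF JI[OF s]] this D]
    have "A' s = ?g s *v (\<kappa> s *\<^sub>R (cov_deriv M I \<gamma> N s c - ?C s *v N s c) + k' *\<^sub>R N s c)
        + (transpose (?C s) ** ?g s + ?g s ** ?C s) *v (\<kappa> s *\<^sub>R N s c)"
      .
    \<comment> \<open>The terms g C N cancel, so C survives only as its transpose. Pairing with
      \<open>B\<close> then removes the terms in g N and g T and leaves \<kappa> \<tau> plus one
      term with C.\<close>
    also have "\<dots> = k' *\<^sub>R (?g s *v N s c) - (\<kappa> s)\<^sup>2 *\<^sub>R (?g s *v T s c) + (\<kappa> s * \<tau> s) *\<^sub>R (?g s *v B s c)
        + \<kappa> s *\<^sub>R (transpose (?C s) *v (?g s *v N s c))"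
      unfolding frenet_equations(2)[OF JI[OF s]]
      by (simp add: tscale_def matrix_vector_mult_scaleR matrix_vector_right_distrib
          matrix_vector_mult_diff_distrib matrix_vector_mult_add_rdistrib
          matrix_vector_mul_assoc[symmetric] algebra_simps power2_eq_square del: transpose_matrix_vector)
    finally have "B s c \<bullet> A' s = \<kappa> s * \<tau> s + \<kappa> s * ((?C s *v B s c) \<bullet> (?g s *v N s c))"
      by (simp add: inner_add_right inner_diff_right frame_chart[OF c(1) s]
          inner_matrix_vector_transpose del: transpose_matrix_vector)
    \<comment> \<open>Symmetry of g brings C next to g, since it is the product g C that is known to
      be differentiable.\<close>
    moreover have "(?C s *v B s c) \<bullet> (?g s *v N s c) = N s c \<bullet> ((?g s ** ?C s) *v B s c)"
      by (metis inner_matrix_vector_transpose gram_symmetric[OF c(1) s] inner_commute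
          matrix_vector_mul_assoc)
    ultimately show "(B s c \<bullet> A' s) / \<kappa> s - N s c \<bullet> ((?g s ** ?C s) *v B s c) = \<tau> s"
      using curvature_pos[OF JI[OF s]] by (simp add: field_simps)
  next
    have d1: "A' differentiable (at t within I)" "(\<lambda>t. ?g t ** ?C t) differentiable (at t within I)"
      by (intro iter_differentiable_on_imp_differentiable[OF c] A'_iter
          iter_differentiable_on_gram_connection_matrix c)+
    show "(\<lambda>s. (B s c \<bullet> A' s) / \<kappa> s - N s c \<bullet> ((?g s ** ?C s) *v B s c)) differentiable (at t within I)"
      using curvature_pos[OF JI[OF c(2)]]
      by (intro differentiable_diff differentiable_divide
          differentiable_bounded_bilinear[OF bounded_bilinear_inner]
          differentiable_bounded_bilinear[OF bounded_bilinear_matrix_vector_mult]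
          d1 \<kappa> c diff[OF frame_fields(2) c(2)] diff[OF frame_fields(3) c(2)]) auto
  qed
qed

lemma curvature_torsion_differentiable:
  assumes "t \<in> I"
  shows "\<kappa> differentiable (at t within I)" and "\<tau> differentiable (at t within I)"
  using charts_at_nonempty[OF assms] curvature_torsion_differentiable_chart charts_at_iff[OF assms]
  by metis+

section \<open>Slant helices\<close>

lemma rnorm_frame: "t \<in> I \<Longrightarrow> rnorm M (\<gamma> t) (N t) = 1"
  by (simp add: rnorm_def frame_orthonormal)

lemma rinner_frame_expansion:
  assumes "t \<in> I" "v \<in> tangent_space M (\<gamma> t)"
  shows "rinner M (\<gamma> t) v v
    = (rinner M (\<gamma> t) (T t) v)\<^sup>2 + (rinner M (\<gamma> t) (N t) v)\<^sup>2 + (rinner M (\<gamma> t) (B t) v)\<^sup>2"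
  using rinner_frame_combination(2)[OF assms(1)] frame_expansion[OF assms] by metis

lemma slant_D_eq:
  "a *\<^sub>T slant_D \<kappa> \<tau> T B t = (a * \<tau> t / rho t) *\<^sub>T T t + (a * \<kappa> t / rho t) *\<^sub>T B t"
  by (rule ext) (simp add: slant_D_def tscale_def scaleR_add_right)

lemma slant_sigma_eq:
  assumes "t \<in> I" "((\<lambda>u. \<tau> u / \<kappa> u) has_real_derivative D) (at t within I)"
  shows "slant_sigma I \<kappa> \<tau> t = (\<kappa> t)\<^sup>2 / (rho t)^3 * D"
proof -
  have "0 < (\<kappa> t)\<^sup>2 + (\<tau> t)\<^sup>2"
    using rho_pos[OF assms(1)] by (simp add: add.commute)
  then have "((\<kappa> t)\<^sup>2 + (\<tau> t)\<^sup>2) powr (3/2) = (((\<kappa> t)\<^sup>2 + (\<tau> t)\<^sup>2) powr (1/2)) ^ 3"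
    by (subst powr_power) auto
  also have "\<dots> = (rho t)^3"
    by (simp add: powr_half_sqrt add.commute)
  finally have "((\<kappa> t)\<^sup>2 + (\<tau> t)\<^sup>2) powr (3/2) = (rho t)^3" .
  moreover have "vector_derivative (\<lambda>u. \<tau> u / \<kappa> u) (at t within I) = D"
    using assms vector_derivative_within[OF at_within_neq_bot[OF assms(1)]]
    by (simp add: has_real_derivative_iff_has_vector_derivative)
  ultimately show ?thesis by (simp add: slant_sigma_def)
qed

text \<open>Holds the formula for the axis and one implication of the equivalence. The same \<theta>
  serves for all times; its sine may be negative, so it may differ from the angle given by
  \<open>rangle\<close>.\<close>

lemma slant_axis_components:
  assumes "slant_axis M I \<gamma> N V"
  obtains \<theta> where "sin \<theta> \<noteq> 0"
    and "\<And>t. t \<in> I \<Longrightarrow> rinner M (\<gamma> t) (N t) (V t) = cos \<theta>"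
    and "\<And>t. t \<in> I \<Longrightarrow> slant_sigma I \<kappa> \<tau> t = cot \<theta>"
    and "\<And>t. t \<in> I \<Longrightarrow> V t = cos \<theta> *\<^sub>T N t + sin \<theta> *\<^sub>T slant_D \<kappa> \<tau> T B t"
proof -
  have V: "vector_field_along M I \<gamma> V" and V1: "\<And>t. t \<in> I \<Longrightarrow> rinner M (\<gamma> t) (V t) (V t) = 1"
    and dV: "\<And>t. t \<in> I \<Longrightarrow> cov_deriv M I \<gamma> V t = 0"
    using assms unfolding slant_axis_def rnorm_def real_sqrt_eq_1_iff by blast+
  obtain \<alpha> where \<alpha>: "\<And>t. t \<in> I \<Longrightarrow> rangle M (\<gamma> t) (N t) (V t) = \<alpha>"
    using assms unfolding slant_axis_def by blast
  have VT: "\<And>t. t \<in> I \<Longrightarrow> V t \<in> tangent_space M (\<gamma> t)"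
    using V by (simp add: vector_field_along_def)
  define a where "a t = rinner M (\<gamma> t) (T t) (V t)" for t
  define n where "n t = rinner M (\<gamma> t) (N t) (V t)" for t
  define b where "b t = rinner M (\<gamma> t) (B t) (V t)" for t
  have sq: "(a t)\<^sup>2 + (n t)\<^sup>2 + (b t)\<^sup>2 = 1" if "t \<in> I" for t
    using rinner_frame_expansion[OF that VT[OF that]] V1[OF that] by (simp add: a_def n_def b_def)
  \<comment> \<open>As \<open>V\<close> is parallel, only the frame vectors contribute to the
    derivatives of the components.\<close>
  have a': "(a has_real_derivative \<kappa> t * n t) (at t within I)"
    and n': "(n has_real_derivative - \<kappa> t * a t + \<tau> t * b t) (at t within I)"
    and b': "(b has_real_derivative - \<tau> t * n t) (at t within I)" if "t \<in> I" for t
    using rinner_has_derivative[OF frame_fields(1) V that] rinner_has_derivative[OF frame_fields(2) V that]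
      rinner_has_derivative[OF frame_fields(3) V that]
    by (simp_all add: dV[OF that] frenet_equations[OF that] rinner_bilinear
        a_def[symmetric] n_def[symmetric] b_def[symmetric])
  define c0 where "c0 = cos \<alpha>"
  have n: "n t = c0" if t: "t \<in> I" for t
  proof -
    \<comment> \<open>The bound places \<open>n t\<close> where \<open>cos\<close> inverts
      \<open>arccos\<close>, so a constant angle gives a constant component.\<close>
    have "(n t)\<^sup>2 \<le> 1"
      using sq[OF t] by (metis add.commute add_increasing2 le_add_same_cancel1 zero_le_power2 add.assoc order_refl)
    then have "\<bar>n t\<bar> \<le> 1" by (simp add: abs_square_le_1)
    moreover have "arccos (n t) = \<alpha>"
      using \<alpha>[OF t] V1[OF t] by (simp add: rangle_def rnorm_frame[OF t] n_def) (simp add: rnorm_def)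
    ultimately show ?thesis unfolding c0_def by (metis cos_arccos_abs)
  qed
  have ratio: "\<kappa> t * a t = \<tau> t * b t" if t: "t \<in> I" for t
  proof -
    have "(n has_vector_derivative 0) (at t within I)"
      by (rule has_vector_derivative_transform[OF t n has_vector_derivative_const])
    from vector_derivative_unique_within[OF at_within_neq_bot[OF t] this
        n'[OF t, unfolded has_real_derivative_iff_has_vector_derivative]]
    show ?thesis by simp
  qed
  \<comment> \<open>A zero of \<open>b\<close> is a zero of \<open>a\<close>, so the constant
    \<open>c0\<close> is 1 or -1. Then \<open>a\<close> vanishes on all of \<open>I\<close>, and its
    derivative \<kappa> n would be 0, against \<kappa> > 0.\<close>
  have b_nz: "b t \<noteq> 0" if t: "t \<in> I" for t
  proof
    assume "b t = 0"
    moreover from this have "a t = 0" using ratio[OF t] curvature_pos[OF t] by simp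
    ultimately have c0: "c0\<^sup>2 = 1" using sq[OF t] n[OF t] by simp
    have "a s = 0" if "s \<in> I" for s
      using sq[OF that] n[OF that] c0 by (simp add: add_nonneg_eq_0_iff)
    then have "(a has_vector_derivative 0) (at t within I)"
      by (rule has_vector_derivative_transform[OF t _ has_vector_derivative_const])
    from vector_derivative_unique_within[OF at_within_neq_bot[OF t] this
        a'[OF t, unfolded has_real_derivative_iff_has_vector_derivative]]
    show False using curvature_pos[OF t] n[OF t] c0 by auto
  qed
  \<comment> \<open>The coefficient of \<open>V\<close> along D. Its square is constant by the unit
    length of \<open>V\<close>; its sign still has to be fixed.\<close>
  define l where "l t = b t * rho t / \<kappa> t" for t
  have l_sq: "(l t)\<^sup>2 = 1 - c0\<^sup>2" if t: "t \<in> I" for t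
  proof -
    have "a t = \<tau> t * b t / \<kappa> t" using ratio[OF t] curvature_pos[OF t] by (simp add: field_simps)
    moreover have "(a t)\<^sup>2 + (b t)\<^sup>2 = 1 - c0\<^sup>2" using sq[OF t] n[OF t] by simp
    moreover have "(l t)\<^sup>2 = (\<tau> t * b t / \<kappa> t)\<^sup>2 + (b t)\<^sup>2"
      using curvature_pos[OF t] by (simp add: l_def power_mult_distrib power_divide field_simps)
    ultimately show ?thesis by simp
  qed
  obtain t0 where t0: "t0 \<in> I" using interior_nonempty interior_subset by blast
  have l: "l t = l t0" if t: "t \<in> I" for t
  proof -
    \<comment> \<open>The image of \<open>I\<close> under \<open>b\<close> is an interval without 0,
      so \<open>b\<close>, and with it \<open>l\<close>, keeps its sign.\<close>
    have "continuous_on I b"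
      using b' by (auto simp: continuous_on_eq_continuous_within intro: DERIV_continuous)
    then have "is_interval (b ` I)"
      using interval by (simp add: is_interval_connected_1 connected_continuous_image)
    then have "0 \<in> b ` I" if "b s < 0" "b r > 0" "s \<in> I" "r \<in> I" for s r
      using that mem_is_interval_1_I[of "b ` I" "b s" "b r" 0] by simp
    then have "(b t > 0) = (b t0 > 0)" using b_nz t t0 by (metis imageE linorder_neqE)
    moreover have "(l s > 0) = (b s > 0)" if "s \<in> I" for s
      using curvature_pos[OF that] rho_pos[OF that]
      by (simp add: l_def zero_less_divide_iff zero_less_mult_iff)
    ultimately have "(l t > 0) = (l t0 > 0)" using t t0 by simp
    moreover have "l t = l t0 \<or> l t = - l t0" using l_sq t t0 by (simp add: power2_eq_iff[symmetric])
    ultimately show ?thesis by linarith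
  qed
  have l_nz: "l t0 \<noteq> 0" using b_nz[OF t0] rho_pos[OF t0] curvature_pos[OF t0] by (simp add: l_def)
  \<comment> \<open>The point with coordinates \<open>c0\<close> and \<open>l t0\<close> lies on the
    unit circle. A full turn of angles is allowed because \<open>l t0\<close> may have either
    sign.\<close>
  obtain \<theta> where \<theta>: "c0 = cos \<theta>" "l t0 = sin \<theta>"
    using sincos_total_2pi[of c0 "l t0"] l_sq[OF t0] by auto
  have b_eq: "b t = sin \<theta> * \<kappa> t / rho t" if t: "t \<in> I" for t
  proof -
    have "b t * rho t / \<kappa> t = sin \<theta>" using l[OF t] \<theta>(2) by (simp add: l_def)
    then show ?thesis using curvature_pos[OF t] rho_pos[OF t] by (simp add: field_simps)
  qed
  have a_eq: "a t = sin \<theta> * \<tau> t / rho t" if t: "t \<in> I" for t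
    using ratio[OF t] curvature_pos[OF t] rho_pos[OF t] by (simp add: b_eq[OF t] field_simps)
  show ?thesis
  proof
    show s_nz: "sin \<theta> \<noteq> 0" using l_nz \<theta> by simp
    fix t assume t: "t \<in> I"
    show "rinner M (\<gamma> t) (N t) (V t) = cos \<theta>" using n[OF t] \<theta> by (simp add: n_def)
    show "V t = cos \<theta> *\<^sub>T N t + sin \<theta> *\<^sub>T slant_D \<kappa> \<tau> T B t"
      using frame_expansion[OF t VT[OF t]] n[OF t] \<theta>(1)
      unfolding slant_D_eq a_def[symmetric] n_def[symmetric] b_def[symmetric] a_eq[OF t] b_eq[OF t]
      by (simp add: add_ac)
    \<comment> \<open>The derivative of \<tau>/\<kappa> is found from that of
      \<open>a\<close>/\<open>b\<close>, the same function on \<open>I\<close>.\<close>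
    have quot: "((\<lambda>t. a t / b t) has_real_derivative (\<kappa> t * n t * b t - a t * (- \<tau> t * n t)) / (b t * b t))
        (at t within I)"
      by (rule DERIV_divide[OF a'[OF t] b'[OF t] b_nz[OF t]])
    have "\<tau> s / \<kappa> s = a s / b s" if "s \<in> I" for s
      using ratio[OF that] b_nz[OF that] curvature_pos[OF that] by (simp add: field_simps)
    then have "((\<lambda>t. \<tau> t / \<kappa> t) has_real_derivative
        (\<kappa> t * n t * b t - a t * (- \<tau> t * n t)) / (b t * b t)) (at t within I)"
      using quot unfolding has_real_derivative_iff_has_vector_derivative
      by (rule has_vector_derivative_transform[OF t])
    then have "slant_sigma I \<kappa> \<tau> t = (\<kappa> t)\<^sup>2 / (rho t)^3 *
        ((\<kappa> t * n t * b t - a t * (- \<tau> t * n t)) / (b t * b t))"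
      by (rule slant_sigma_eq[OF t])
    \<comment> \<open>Here \<kappa> b + \<tau> a = sin \<theta> (\<tau>^2 + \<kappa>^2) /
      \<open>rho\<close>. Writing the bracket as \<open>rho\<close>^2 leaves an identity of rational
      functions.\<close>
    also have "\<dots> = (\<kappa> t)\<^sup>2 / (rho t)^3 *
        (cos \<theta> * sin \<theta> * ((\<tau> t)\<^sup>2 + (\<kappa> t)\<^sup>2) / rho t / (sin \<theta> * \<kappa> t / rho t)\<^sup>2)"
      unfolding a_eq[OF t] b_eq[OF t] n[OF t] \<theta>(1)
      by (simp add: power2_eq_square add_divide_distrib algebra_simps)
    also have "\<dots> = (\<kappa> t)\<^sup>2 / (rho t)^3 *
        (cos \<theta> * sin \<theta> * (rho t)\<^sup>2 / rho t / (sin \<theta> * \<kappa> t / rho t)\<^sup>2)"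
      by simp
    also have "\<dots> = cot \<theta>"
    proof -
      have "k\<^sup>2 / r^3 * (c * s * r\<^sup>2 / r / (s * k / r)\<^sup>2) = c / s"
        if "k \<noteq> 0" "r \<noteq> 0" "s \<noteq> 0" for k r s c :: real
        using that by (simp add: field_simps power2_eq_square power3_eq_cube)
      from this[of "\<kappa> t" "rho t" "sin \<theta>" "cos \<theta>"] show ?thesis
        using curvature_pos[OF t] rho_pos[OF t] s_nz by (simp only: cot_def) force
    qed
    finally show "slant_sigma I \<kappa> \<tau> t = cot \<theta>" .
  qed
qed

lemma slant_helix_imp_sigma_stationary:
  assumes "slant_helix M I \<gamma> N" "t \<in> I"
  shows "(slant_sigma I \<kappa> \<tau> has_real_derivative 0) (at t within I)"
proof -
  obtain V where V: "slant_axis M I \<gamma> N V" using assms(1) by (auto simp: slant_helix_def)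
  then obtain \<theta> where "\<And>s. s \<in> I \<Longrightarrow> slant_sigma I \<kappa> \<tau> s = cot \<theta>"
    using slant_axis_components by metis
  then show ?thesis
    unfolding has_real_derivative_iff_has_vector_derivative
    by (rule has_vector_derivative_transform[OF assms(2) _ has_vector_derivative_const])
qed

text \<open>A constant sigma determines the angle by its cotangent, and the field with the resulting
  components along N and D turns out to be parallel.\<close>

lemma sigma_stationary_imp_slant_helix:
  assumes "\<And>t. t \<in> I \<Longrightarrow> (slant_sigma I \<kappa> \<tau> has_real_derivative 0) (at t within I)"
  shows "slant_helix M I \<gamma> N"
proof -
  have "convex I" using interval is_interval_convex by blast
  from has_field_derivative_zero_constant[OF this assms]
  obtain s0 where s0: "\<And>t. t \<in> I \<Longrightarrow> slant_sigma I \<kappa> \<tau> t = s0" by blast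
  \<comment> \<open>With s0 = cot \<theta> and \<theta> between 0 and pi, \<open>l\<close> is sin
    \<theta> and \<open>n\<close> is cos \<theta>.\<close>
  define l where "l = 1 / sqrt (1 + s0\<^sup>2)"
  define n where "n = s0 / sqrt (1 + s0\<^sup>2)"
  have n_l: "n = l * s0" by (simp add: l_def n_def)
  have "1 + s0\<^sup>2 > 0" by (simp add: add_pos_nonneg)
  then have unit: "l\<^sup>2 + n\<^sup>2 = 1"
    by (simp add: l_def n_def power_divide add_divide_distrib[symmetric])
  define a where "a t = l * (\<tau> t / rho t)" for t
  define b where "b t = l * (\<kappa> t / rho t)" for t
  define V where "V t = a t *\<^sub>T T t + n *\<^sub>T N t + b t *\<^sub>T B t" for t
  \<comment> \<open>The quotient rule for a denominator r whose derivative is z/r, as is the case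
    for \<open>rho\<close>, brought over r^3.\<close>
  have quotient: "(x * r - y * (z / r)) / (r * r) = (x * r\<^sup>2 - y * z) / r^3" if "r \<noteq> 0" for x y z r :: real
    using that by (simp add: field_simps power2_eq_square power3_eq_cube)
  have a': "(a has_real_derivative \<kappa> t * n) (at t within I)"
    and b': "(b has_real_derivative - \<tau> t * n) (at t within I)" if t: "t \<in> I" for t
  proof -
    obtain k' p' where k': "(\<kappa> has_real_derivative k') (at t within I)"
      and p': "(\<tau> has_real_derivative p') (at t within I)"
      using curvature_torsion_differentiable[OF t] by (auto simp: real_differentiable_def)
    note k = curvature_pos[OF t] and r = rho_pos[OF t]
    have "s0 = (\<kappa> t)\<^sup>2 / (rho t)^3 * ((p' * \<kappa> t - \<tau> t * k') / (\<kappa> t * \<kappa> t))"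
      using slant_sigma_eq[OF t DERIV_divide[OF p' k']] s0[OF t] k by simp
    \<comment> \<open>The factor \<kappa>^2 of sigma cancels the denominator of the derivative of
      \<tau>/\<kappa>.\<close>
    then have s0_eq: "s0 = (p' * \<kappa> t - \<tau> t * k') / (rho t)^3"
      using k by (simp add: power2_eq_square)
    have rho': "(rho has_real_derivative (\<tau> t * p' + \<kappa> t * k') / rho t) (at t within I)"
      using r by (auto intro!: derivative_eq_intros p' k' simp: divide_simps)
    have "(p' * rho t - \<tau> t * ((\<tau> t * p' + \<kappa> t * k') / rho t)) / (rho t * rho t) =
        (p' * (rho t)\<^sup>2 - \<tau> t * (\<tau> t * p' + \<kappa> t * k')) / (rho t)^3"
      by (rule quotient) (use k in simp)
    \<comment> \<open>Inserting \<open>rho\<close>^2 = \<tau>^2 + \<kappa>^2 leaves \<kappa> times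
      the numerator of \<open>s0_eq\<close>; for \<open>b\<close> below the factor is
      -\<tau>.\<close>
    also have "p' * (rho t)\<^sup>2 - \<tau> t * (\<tau> t * p' + \<kappa> t * k') = \<kappa> t * (p' * \<kappa> t - \<tau> t * k')"
      by (simp add: power2_eq_square algebra_simps)
    finally have a_eq: "(p' * rho t - \<tau> t * ((\<tau> t * p' + \<kappa> t * k') / rho t)) / (rho t * rho t) = \<kappa> t * s0"
      by (simp add: s0_eq)
    have "((\<lambda>t. \<tau> t / rho t) has_real_derivative \<kappa> t * s0) (at t within I)"
      unfolding a_eq[symmetric] by (rule DERIV_divide[OF p' rho']) (use k in simp)
    from DERIV_cmult[OF this, of l] show "(a has_real_derivative \<kappa> t * n) (at t within I)"
      by (simp add: a_def[abs_def] n_l mult_ac)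
    have "(k' * rho t - \<kappa> t * ((\<tau> t * p' + \<kappa> t * k') / rho t)) / (rho t * rho t) =
        (k' * (rho t)\<^sup>2 - \<kappa> t * (\<tau> t * p' + \<kappa> t * k')) / (rho t)^3"
      by (rule quotient) (use k in simp)
    also have "k' * (rho t)\<^sup>2 - \<kappa> t * (\<tau> t * p' + \<kappa> t * k') = - \<tau> t * (p' * \<kappa> t - \<tau> t * k')"
      by (simp add: power2_eq_square algebra_simps)
    finally have b_eq: "(k' * rho t - \<kappa> t * ((\<tau> t * p' + \<kappa> t * k') / rho t)) / (rho t * rho t) = - \<tau> t * s0"
      by (simp add: s0_eq)
    have "((\<lambda>t. \<kappa> t / rho t) has_real_derivative - \<tau> t * s0) (at t within I)"
      unfolding b_eq[symmetric] by (rule DERIV_divide[OF k' rho']) (use k in simp)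
    from DERIV_cmult[OF this, of l] show "(b has_real_derivative - \<tau> t * n) (at t within I)"
      by (simp add: b_def[abs_def] n_l mult_ac)
  qed
  have fields: "vector_field_along M I \<gamma> (\<lambda>t. a t *\<^sub>T T t)" "vector_field_along M I \<gamma> (\<lambda>t. n *\<^sub>T N t)"
    "vector_field_along M I \<gamma> (\<lambda>t. b t *\<^sub>T B t)"
    by (intro vector_field_along_tscale frame_fields differentiable_const;
        use a' b' in \<open>blast intro: real_differentiable_def[THEN iffD2]\<close>)+
  have "slant_axis M I \<gamma> N V"
    unfolding slant_axis_def
  proof (intro conjI ballI exI)
    show "vector_field_along M I \<gamma> V"
      unfolding V_def by (intro vector_field_along_add fields)
    fix t assume t: "t \<in> I"
    have "(a t)\<^sup>2 + (b t)\<^sup>2 = l\<^sup>2 * (((\<tau> t)\<^sup>2 + (\<kappa> t)\<^sup>2) / (rho t)\<^sup>2)"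
      by (simp only: a_def b_def power_mult_distrib power_divide add_divide_distrib distrib_left)
    also have "\<dots> = l\<^sup>2"
      using curvature_pos[OF t] by simp
    finally have "(a t)\<^sup>2 + (b t)\<^sup>2 = l\<^sup>2" .
    then have "rinner M (\<gamma> t) (V t) (V t) = 1"
      using unit unfolding V_def rinner_frame_combination(2)[OF t] by simp
    then show V1: "rnorm M (\<gamma> t) (V t) = 1" by (simp add: rnorm_def)
    show "rangle M (\<gamma> t) (N t) (V t) = arccos n"
      unfolding rangle_def V1 rnorm_frame[OF t]
      by (simp add: V_def rinner_frame_combination(1)[OF t])
    \<comment> \<open>This kills the coefficient of N in the covariant derivative of
      \<open>V\<close>. Those of T and B vanish by the choice of the derivatives of \<open>a\<close>
      and \<open>b\<close>.\<close>
    have "a t * \<kappa> t = b t * \<tau> t" by (simp add: a_def b_def)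
    moreover have "cov_deriv M I \<gamma> V t = (\<kappa> t * n) *\<^sub>T T t + a t *\<^sub>T \<kappa> t *\<^sub>T N t
        + (0 *\<^sub>T N t + n *\<^sub>T ((- \<kappa> t) *\<^sub>T T t + \<tau> t *\<^sub>T B t))
        + ((- \<tau> t * n) *\<^sub>T B t + b t *\<^sub>T (- \<tau> t) *\<^sub>T N t)"
      unfolding V_def
      by (simp only: cov_deriv_add[OF vector_field_along_add[OF fields(1,2)] fields(3) t]
          cov_deriv_add[OF fields(1,2) t]
          cov_deriv_tscale[OF frame_fields(1) a'[OF t] t] cov_deriv_tscale[OF frame_fields(2) DERIV_const t]
          cov_deriv_tscale[OF frame_fields(3) b'[OF t] t] frenet_equations[OF t])
    ultimately show "cov_deriv M I \<gamma> V t = 0"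
      by (simp add: fun_eq_iff tscale_def scaleR_add_right scaleR_diff_right mult.commute)
  qed
  then show ?thesis by (auto simp: slant_helix_def)
qed

end

theorem theorem2:
  fixes M :: "'p riemannian" and I :: "real set" and \<gamma> :: "real \<Rightarrow> 'p"
    and \<omega> :: "real \<Rightarrow> 'p chart \<Rightarrow> real" and \<kappa> \<tau> :: "real \<Rightarrow> real"
    and T N B :: "real \<Rightarrow> 'p tangent"
  assumes "riemannian_3_manifold M"
    and "is_interval I" and "interior I \<noteq> {}"
    and "smooth_curve M I \<gamma>" and "unit_speed M I \<gamma>"
    and "orientation_along M I \<gamma> \<omega>"
    and "frenet_frame M I \<gamma> \<omega> \<kappa> \<tau> T N B"
    and "\<forall>s\<in>I. \<kappa> s > 0"
  shows "(slant_helix M I \<gamma> N \<longleftrightarrow>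
            (\<forall>s\<in>I. (slant_sigma I \<kappa> \<tau> has_real_derivative 0) (at s within I))) \<and>
         (\<forall>V. slant_axis M I \<gamma> N V \<longrightarrow>
            (\<exists>\<theta>. sin \<theta> \<noteq> 0 \<and> (\<forall>s\<in>I.
               rinner M (\<gamma> s) (N s) (V s) = cos \<theta> \<and>
               slant_sigma I \<kappa> \<tau> s = cot \<theta> \<and>
               V s = cos \<theta> *\<^sub>T N s + sin \<theta> *\<^sub>T slant_D \<kappa> \<tau> T B s)))"
proof -
  interpret frenet_curve M I \<gamma> \<omega> \<kappa> \<tau> T N B
    using assms by unfold_locales auto
  show ?thesis
    using slant_helix_imp_sigma_stationary sigma_stationary_imp_slant_helix
    by (auto elim!: slant_axis_components)
qed

end
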